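(* Let $\gamma:\mathbb{R}\to\mathbb{R}^n$ be a smooth immersion, let $\Lambda>0$, and let $\zeta\in C_c^\infty(\mathbb{R})$ satisfy $\zeta\ge0$ and $|\partial_s\zeta|\le\Lambda$, where $\partial_s\zeta=|\partial_x\gamma|^{-1}\partial_x\zeta$. Let $k\in\mathbb{N}$, $a,b,c\in\mathbb{N}_0$, $b\ge2$, and suppose $c\le k$ and $a+\frac b2-1<2k$. Then, for any $\varepsilon>0$, there exists $C=C(\varepsilon,\Lambda,a,b,k)$ (in particular independent of $\gamma$ and $\zeta$) such that $$\int|P^{a,c}_b|\,\zeta^{a+\frac b2-1}\,ds\le\varepsilon\int|\nabla_s^k\kappa|^2\zeta^{2k}\,ds+C\Big(\int_{[\zeta>0]}|\kappa|^2\,ds\Big)^{\frac{b-\delta}{2-\delta}}+C\Big(\int_{[\zeta>0]}|\kappa|^2\,ds\Big)^{\frac b2}$$ with $\delta=\frac1k\big(a+\frac b2-1\big)<2$.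
   Context: $\mathbb{N}$ is the set of positive integers and $\mathbb{N}_0=\mathbb{N}\cup\{0\}$; $n\ge2$. Along $\gamma$: $\partial_s=|\partial_x\gamma|^{-1}\partial_x$, $ds=|\partial_x\gamma|\,dx$, $\kappa=\partial_s^2\gamma$, and $\nabla_sf=\partial_sf-\langle\partial_sf,\partial_s\gamma\rangle\partial_s\gamma$; $\nabla_s^i$ is the $i$-fold iterate. $[\zeta>0]=\{x\in\mathbb{R}:\zeta(x)>0\}$; all integrals are over (subsets of) $\mathbb{R}$, and $\zeta^0$ is understood as the indicator function of $[\zeta>0]$. Notation $P^{a,c}_b$: any linear combination, with universal real coefficients, of terms of the form $\nabla_s^{i_1}\kappa*\dots*\nabla_s^{i_b}\kappa$ (scalars or normal vector fields along $\gamma$), where $i_j\in\mathbb{N}_0$, $i_j\le c$ for all $j=1,\dots,b$ and $\sum_{j=1}^b i_j=a$. Here $*$ denotes a multilinear product built from the Euclidean inner product: the factors are paired by inner products, giving a scalar if $b$ is even, and a scalar times the one remaining factor (a normal vector field) if $b$ is odd; in particular $|\nabla_s^{i_1}\kappa*\dots*\nabla_s^{i_b}\kappa|\le\prod_{j=1}^b|\nabla_s^{i_j}\kappa|$. The coefficients are fixed independently of $\gamma$ and $\zeta$, and constants are allowed to depend on them. *)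

theory Defs
  imports "HOL-Analysis.Analysis"
begin

text \<open>
  A vector of \<open>\<real>\<^sup>n\<close> is a function \<open>nat \<Rightarrow> real\<close> in \<open>topspace (Euclidean_space n)\<close>,
  that is, one vanishing at all indices \<open>\<ge> n\<close>. The dimension is a number and not a
  type because the constants below are to be uniform in \<open>n\<close>.
\<close>

type_synonym rvec = "nat \<Rightarrow> real"

definition vdot :: "nat \<Rightarrow> rvec \<Rightarrow> rvec \<Rightarrow> real" where
  "vdot n u v = (\<Sum>i<n. u i * v i)"

definition vnorm :: "nat \<Rightarrow> rvec \<Rightarrow> real" where
  "vnorm n v = L2_set v {..<n}"

definition smooth :: "(real \<Rightarrow> real) \<Rightarrow> bool" where
  "smooth f \<longleftrightarrow> (\<forall>m x. (deriv ^^ m) f differentiable (at x))"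

definition vderiv :: "(real \<Rightarrow> rvec) \<Rightarrow> real \<Rightarrow> rvec" where
  "vderiv V x = (\<lambda>i. deriv (\<lambda>y. V y i) x)"

definition smooth_immersion :: "nat \<Rightarrow> (real \<Rightarrow> rvec) \<Rightarrow> bool" where
  "smooth_immersion n \<gamma> \<longleftrightarrow>
     (\<forall>x. \<gamma> x \<in> topspace (Euclidean_space n)) \<and>
     (\<forall>i<n. smooth (\<lambda>x. \<gamma> x i)) \<and>
     (\<forall>x. \<exists>i<n. vderiv \<gamma> x i \<noteq> 0)"

definition speed :: "nat \<Rightarrow> (real \<Rightarrow> rvec) \<Rightarrow> real \<Rightarrow> real" where
  "speed n \<gamma> x = vnorm n (vderiv \<gamma> x)"

definition ds_scalar :: "nat \<Rightarrow> (real \<Rightarrow> rvec) \<Rightarrow> (real \<Rightarrow> real) \<Rightarrow> real \<Rightarrow> real" where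
  "ds_scalar n \<gamma> f x = deriv f x / speed n \<gamma> x"

definition ds_vec :: "nat \<Rightarrow> (real \<Rightarrow> rvec) \<Rightarrow> (real \<Rightarrow> rvec) \<Rightarrow> real \<Rightarrow> rvec" where
  "ds_vec n \<gamma> V x = (\<lambda>i. vderiv V x i / speed n \<gamma> x)"

definition integral_ds :: "nat \<Rightarrow> (real \<Rightarrow> rvec) \<Rightarrow> real set \<Rightarrow> (real \<Rightarrow> real) \<Rightarrow> real" where
  "integral_ds n \<gamma> A f = (LINT x:A|lborel. f x * speed n \<gamma> x)"

definition curvature :: "nat \<Rightarrow> (real \<Rightarrow> rvec) \<Rightarrow> real \<Rightarrow> rvec" where
  "curvature n \<gamma> = ds_vec n \<gamma> (ds_vec n \<gamma> \<gamma>)"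

definition nabla_s :: "nat \<Rightarrow> (real \<Rightarrow> rvec) \<Rightarrow> (real \<Rightarrow> rvec) \<Rightarrow> real \<Rightarrow> rvec" where
  "nabla_s n \<gamma> V x =
     (\<lambda>i. ds_vec n \<gamma> V x i - vdot n (ds_vec n \<gamma> V x) (ds_vec n \<gamma> \<gamma> x) * ds_vec n \<gamma> \<gamma> x i)"

definition nabla_curv :: "nat \<Rightarrow> (real \<Rightarrow> rvec) \<Rightarrow> nat \<Rightarrow> real \<Rightarrow> rvec" where
  "nabla_curv n \<gamma> i = (nabla_s n \<gamma> ^^ i) (curvature n \<gamma>)"

text \<open>
  The product \<open>v\<^sub>1 * \<dots> * v\<^sub>b\<close> pairs consecutive factors; an odd last factor remains as a
  vector. Every other pairing of the factors is this one after a permutation of the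
  list, so nothing is lost when arbitrary lists of factors are admitted. The even
  (scalar) and odd (vector) cases have different types and are separate functions;
  each one is only meaningful for lists of its own parity.
\<close>

fun star_scalar :: "nat \<Rightarrow> rvec list \<Rightarrow> real" where
  "star_scalar n (u # v # vs) = vdot n u v * star_scalar n vs"
| "star_scalar n [] = 1"
| "star_scalar n [u] = 0"

fun star_vec :: "nat \<Rightarrow> rvec list \<Rightarrow> rvec" where
  "star_vec n (u # v # vs) = (\<lambda>i. vdot n u v * star_vec n vs i)"
| "star_vec n [u] = u"
| "star_vec n [] = (\<lambda>i. 0)"

text \<open>
  A formal linear combination lists pairs of a coefficient and the orders
  \<open>[i\<^sub>1, \<dots>, i\<^sub>b]\<close> of the factors of that term, \<open>i\<^sub>j\<close> standing for the
  \<open>i\<^sub>j\<close>-fold \<open>\<nabla>\<^sub>s\<close>-derivative of \<open>\<kappa>\<close>. It refers neither to a curve nor to a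
  dimension: this is what makes the coefficients universal.
\<close>

type_synonym lincomb = "(real \<times> nat list) list"

definition P_class :: "nat \<Rightarrow> nat \<Rightarrow> nat \<Rightarrow> lincomb set" where
  "P_class a b c =
     {P. \<forall>(r, js) \<in> set P. length js = b \<and> sum_list js = a \<and> (\<forall>j \<in> set js. j \<le> c)}"

text \<open>The pointwise norm \<open>|P|\<close> along \<open>\<gamma>\<close> of a combination of terms with \<open>b\<close> factors.\<close>

definition P_norm :: "nat \<Rightarrow> (real \<Rightarrow> rvec) \<Rightarrow> nat \<Rightarrow> lincomb \<Rightarrow> real \<Rightarrow> real" where
  "P_norm n \<gamma> b P x =
     (if even b
      then \<bar>\<Sum>(r, js) \<leftarrow> P. r * star_scalar n (map (\<lambda>j. nabla_curv n \<gamma> j x) js)\<bar>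
      else vnorm n (\<lambda>i. \<Sum>(r, js) \<leftarrow> P. r * star_vec n (map (\<lambda>j. nabla_curv n \<gamma> j x) js) i))"

text \<open>
  Powers \<open>\<zeta>\<^sup>p\<close> with real \<open>p \<ge> 0\<close> are written with \<open>powr\<close>. As \<open>0 powr 0 = 0\<close> and
  \<open>x powr 0 = 1\<close> for \<open>x > 0\<close>, the power \<open>\<zeta> x powr 0\<close> is the indicator of \<open>\<zeta> > 0\<close>.
\<close>

end

theory Submission
  imports Defs
begin

text \<open>
  Write \<open>A\<^sub>i\<close> for the norm of \<open>\<zeta>\<^sup>i \<nabla>\<^sub>s\<^sup>i \<kappa>\<close> in the space of square integrable functions on
  \<open>[\<zeta> > 0]\<close> with respect to arc length. The derivatives \<open>\<nabla>\<^sub>s\<^sup>i \<kappa>\<close> are normal fields, so \<open>\<nabla>\<^sub>s\<close>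
  satisfies the product rule for their inner products and one can integrate by parts.
  Together with \<open>\<bar>\<partial>\<^sub>s \<zeta>\<bar> \<le> \<Lambda>\<close> this yields (\<open>wnorm_interpolation\<close>, \<open>weighted_sup_bound\<close>)

    \<open>A\<^sub>i\<^sub>+\<^sub>1\<^sup>2 \<le> A\<^sub>i A\<^sub>i\<^sub>+\<^sub>2 + 2 (i + 1) \<Lambda> A\<^sub>i A\<^sub>i\<^sub>+\<^sub>1\<close>,
    \<open>sup \<zeta>\<^sup>2\<^sup>i\<^sup>+\<^sup>1 \<bar>\<nabla>\<^sub>s\<^sup>i \<kappa>\<bar>\<^sup>2 \<le> 2 A\<^sub>i A\<^sub>i\<^sub>+\<^sub>1 + (2 i + 1) \<Lambda> A\<^sub>i\<^sup>2\<close>.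

  By the first inequality the running maxima \<open>b\<^sub>i\<close> of the \<open>A\<^sub>i\<close> are log-convex up to constants.
  Setting \<open>\<rho>\<^sup>k = b\<^sub>k / b\<^sub>0\<close>, one obtains \<open>A\<^sub>i \<le> L A\<^sub>0 \<rho>\<^sup>i\<close> for \<open>i \<le> k\<close> and, for \<open>i < k\<close>, the bound
  \<open>L A\<^sub>0 \<rho>\<^bsup>i + 1/2\<^esup>\<close> for the supremum of \<open>\<zeta>\<^bsup>i + 1/2\<^esup> \<bar>\<nabla>\<^sub>s\<^sup>i \<kappa>\<bar>\<close> (\<open>scaled_bounds\<close>).

  In a term with \<open>b\<close> factors of total order \<open>a < 2 k\<close> at most one factor has order \<open>k\<close>. Take it
  and one further factor in the square integral norm and all others in the supremum norm.
  The weights then add up to \<open>\<zeta>\<close> to the power \<open>a + b/2 - 1\<close>, and the integral of the term is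
  at most a constant times \<open>A\<^sub>0\<^sup>b \<rho>\<^bsup>k \<delta>\<^esup>\<close> (\<open>term_bound\<close>).

  Finally, either \<open>b\<^sub>k\<close> is attained at an order below \<open>k\<close>, in which case \<open>\<rho>\<close> is bounded and the
  integral is at most a multiple of \<open>A\<^sub>0\<^sup>b\<close>, or \<open>b\<^sub>k = A\<^sub>k\<close>, in which case it is at most a multiple of
  \<open>A\<^sub>0\<^bsup>b - \<delta>\<^esup> A\<^sub>k\<^sup>\<delta>\<close>. As \<open>\<delta> < 2\<close>, Young's inequality absorbs the power of \<open>A\<^sub>k\<close>
  (\<open>scaled_product_le\<close>).
\<close>

section \<open>Smooth functions of one real variable\<close>

text \<open>
  Smoothness, taken one derivative at a time: the derivative of a product, an inverse or a
  root involves functions of the same kind, so closure properties go by induction on the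
  number of derivatives that remain.
\<close>

primrec differentiable_times :: "nat \<Rightarrow> (real \<Rightarrow> real) \<Rightarrow> bool" where
  "differentiable_times 0 f \<longleftrightarrow> True"
| "differentiable_times (Suc m) f \<longleftrightarrow>
     (\<forall>x. f differentiable (at x)) \<and> differentiable_times m (deriv f)"

lemma differentiable_times_iff:
  "differentiable_times m f \<longleftrightarrow> (\<forall>j<m. \<forall>x. (deriv ^^ j) f differentiable (at x))"
proof (induction m arbitrary: f)
  case (Suc m)
  show ?case
    unfolding All_less_Suc2 differentiable_times.simps Suc.IH
    by (simp add: funpow_swap1)
qed simp

lemma smooth_iff: "smooth f \<longleftrightarrow> (\<forall>m. differentiable_times m f)"
  unfolding smooth_def differentiable_times_iff by blast

lemma differentiable_times_SucD: "differentiable_times (Suc m) f \<Longrightarrow> differentiable_times m f"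
  by (simp add: differentiable_times_iff)

lemma differentiable_times_const: "differentiable_times m (\<lambda>x. c)"
  by (induction m arbitrary: c) simp_all

lemma deriv_add_fun:
  assumes "\<forall>x::real. f differentiable (at x)" "\<forall>x. g differentiable (at x)"
  shows "deriv (\<lambda>x. f x + g x :: real) = (\<lambda>x. deriv f x + deriv g x)"
proof
  fix x
  show "deriv (\<lambda>x. f x + g x) x = deriv f x + deriv g x"
    using assms by (intro DERIV_imp_deriv DERIV_add) (auto simp: DERIV_deriv_iff_real_differentiable)
qed

lemma deriv_mult_fun:
  assumes "\<forall>x::real. f differentiable (at x)" "\<forall>x. g differentiable (at x)"
  shows "deriv (\<lambda>x. f x * g x :: real) = (\<lambda>x. deriv f x * g x + f x * deriv g x)"
proof
  fix x
  show "deriv (\<lambda>x. f x * g x) x = deriv f x * g x + f x * deriv g x"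
    using DERIV_mult'[of f "deriv f x" x UNIV g "deriv g x"] assms
    by (intro DERIV_imp_deriv) (simp add: DERIV_deriv_iff_real_differentiable add.commute)
qed

lemma differentiable_times_add:
  "differentiable_times m f \<Longrightarrow> differentiable_times m g \<Longrightarrow> differentiable_times m (\<lambda>x. f x + g x)"
  by (induction m arbitrary: f g) (auto simp: deriv_add_fun)

lemma differentiable_times_mult:
  "differentiable_times m f \<Longrightarrow> differentiable_times m g \<Longrightarrow> differentiable_times m (\<lambda>x. f x * g x)"
proof (induction m arbitrary: f g)
  case (Suc m)
  note f = Suc.prems(1) and g = Suc.prems(2)
  have "differentiable_times m (\<lambda>x. deriv f x * g x + f x * deriv g x)"
    using f g
    by (intro differentiable_times_add Suc.IH)
      (simp_all add: differentiable_times_SucD[OF f] differentiable_times_SucD[OF g])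
  then show ?case using f g by (simp add: deriv_mult_fun)
qed simp

text \<open>
  The derivative \<open>- f' f\<^sup>-\<^sup>1 f\<^sup>-\<^sup>1\<close> again contains \<open>f\<^sup>-\<^sup>1\<close>, but needs it one order lower only, so
  the induction on the order closes. The same happens for the square root, whose derivative
  is \<open>f' / (2 \<surd>f)\<close>.
\<close>

lemma differentiable_times_inverse:
  "differentiable_times m f \<Longrightarrow> (\<And>x. f x \<noteq> 0) \<Longrightarrow> differentiable_times m (\<lambda>x. inverse (f x))"
proof (induction m arbitrary: f)
  case (Suc m)
  note f = Suc.prems(1)
  have D: "((\<lambda>x. inverse (f x)) has_real_derivative
      (-1) * (deriv f x * (inverse (f x) * inverse (f x)))) (at x)" for x
    using f Suc.prems(2)[of x]
    by (auto simp: DERIV_deriv_iff_real_differentiable power2_eq_square field_simps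
        intro!: derivative_eq_intros)
  have "differentiable_times m (\<lambda>x. inverse (f x))"
    by (rule Suc.IH[OF differentiable_times_SucD[OF f] Suc.prems(2)])
  then have "differentiable_times m (\<lambda>x. (-1) * (deriv f x * (inverse (f x) * inverse (f x))))"
    using f by (intro differentiable_times_mult) (auto simp: differentiable_times_const)
  moreover have "deriv (\<lambda>x. inverse (f x))
      = (\<lambda>x. (-1) * (deriv f x * (inverse (f x) * inverse (f x))))"
    using DERIV_imp_deriv[OF D] by blast
  ultimately show ?case
    using D unfolding differentiable_times.simps real_differentiable_def by simp blast
qed simp

lemma differentiable_times_sqrt:
  "differentiable_times m f \<Longrightarrow> (\<And>x. f x > 0) \<Longrightarrow> differentiable_times m (\<lambda>x. sqrt (f x))"
proof (induction m arbitrary: f)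
  case (Suc m)
  note f = Suc.prems(1)
  have D: "((\<lambda>x. sqrt (f x)) has_real_derivative
      (1/2) * (deriv f x * inverse (sqrt (f x)))) (at x)" for x
    using f Suc.prems(2)[of x]
    by (auto simp: DERIV_deriv_iff_real_differentiable field_simps
        intro!: derivative_eq_intros)
  have pos: "sqrt (f x) \<noteq> 0" for x using Suc.prems(2)[of x] by simp
  have "differentiable_times m (\<lambda>x. sqrt (f x))"
    by (rule Suc.IH[OF differentiable_times_SucD[OF f] Suc.prems(2)])
  then have "differentiable_times m (\<lambda>x. (1/2) * (deriv f x * inverse (sqrt (f x))))"
    using f pos
    by (intro differentiable_times_mult differentiable_times_inverse)
      (auto simp: differentiable_times_const)
  moreover have "deriv (\<lambda>x. sqrt (f x)) = (\<lambda>x. (1/2) * (deriv f x * inverse (sqrt (f x))))"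
    using DERIV_imp_deriv[OF D] by blast
  ultimately show ?case
    using D unfolding differentiable_times.simps real_differentiable_def by simp blast
qed simp

lemma smooth_const: "smooth (\<lambda>x. c)"
  by (simp add: smooth_iff differentiable_times_const)

lemma smooth_add: "smooth f \<Longrightarrow> smooth g \<Longrightarrow> smooth (\<lambda>x. f x + g x)"
  by (simp add: smooth_iff differentiable_times_add)

lemma smooth_mult: "smooth f \<Longrightarrow> smooth g \<Longrightarrow> smooth (\<lambda>x. f x * g x)"
  by (simp add: smooth_iff differentiable_times_mult)

lemma smooth_diff: "smooth f \<Longrightarrow> smooth g \<Longrightarrow> smooth (\<lambda>x. f x - g x)"
  using smooth_add[of f "\<lambda>x. (-1) * g x"] smooth_mult[OF smooth_const[of "-1"], of g] by simp

lemma smooth_sum: "finite A \<Longrightarrow> (\<And>i. i \<in> A \<Longrightarrow> smooth (f i)) \<Longrightarrow> smooth (\<lambda>x. \<Sum>i\<in>A. f i x)"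
  by (induction A rule: finite_induct) (simp_all add: smooth_const smooth_add)

lemma smooth_divide: "smooth f \<Longrightarrow> smooth g \<Longrightarrow> (\<And>x. g x \<noteq> 0) \<Longrightarrow> smooth (\<lambda>x. f x / g x)"
  unfolding divide_inverse
  by (simp add: smooth_iff differentiable_times_mult differentiable_times_inverse)

lemma smooth_sqrt: "smooth f \<Longrightarrow> (\<And>x. f x > 0) \<Longrightarrow> smooth (\<lambda>x. sqrt (f x))"
  by (simp add: smooth_iff differentiable_times_sqrt)

lemma smooth_deriv: "smooth f \<Longrightarrow> smooth (deriv f)"
  unfolding smooth_iff using differentiable_times.simps(2) by blast

lemma smooth_DERIV: "smooth f \<Longrightarrow> (f has_real_derivative deriv f x) (at x)"
  unfolding smooth_iff DERIV_deriv_iff_real_differentiable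
  using differentiable_times.simps(2) by blast

lemma smooth_continuous: "smooth f \<Longrightarrow> continuous_on UNIV f"
  by (meson DERIV_isCont continuous_at_imp_continuous_on smooth_DERIV)

section \<open>Calculus of normal fields along a curve\<close>

lemma vnorm_eq: "vnorm n v = sqrt (vdot n v v)"
  by (simp add: vnorm_def vdot_def L2_set_def power2_eq_square)

lemma vdot_self_nonneg: "0 \<le> vdot n v v"
  by (simp add: vdot_def sum_nonneg)

lemma vnorm_nonneg: "0 \<le> vnorm n v"
  by (simp add: vnorm_eq vdot_self_nonneg)

lemma vnorm_power2: "(vnorm n v)\<^sup>2 = vdot n v v"
  by (simp add: vnorm_eq vdot_self_nonneg)

lemma abs_vdot_le: "\<bar>vdot n u v\<bar> \<le> vnorm n u * vnorm n v"
proof -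
  have "\<bar>vdot n u v\<bar> \<le> (\<Sum>i<n. \<bar>u i\<bar> * \<bar>v i\<bar>)"
    unfolding vdot_def abs_mult[symmetric] by (rule sum_abs)
  also have "\<dots> \<le> vnorm n u * vnorm n v"
    unfolding vnorm_def by (rule L2_set_mult_ineq)
  finally show ?thesis .
qed

lemma vdot_commute: "vdot n u v = vdot n v u"
  by (simp add: vdot_def mult.commute)

lemma vdot_diff_scale: "vdot n (\<lambda>i. u i - c * v i) w = vdot n u w - c * vdot n v w"
  by (simp add: vdot_def sum_subtractf sum_distrib_left algebra_simps)

definition smooth_field :: "nat \<Rightarrow> (real \<Rightarrow> rvec) \<Rightarrow> bool" where
  "smooth_field n V \<longleftrightarrow> (\<forall>i<n. smooth (\<lambda>x. V x i))"

lemma smooth_vdot: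
  "smooth_field n V \<Longrightarrow> smooth_field n W \<Longrightarrow> smooth (\<lambda>x. vdot n (V x) (W x))"
  unfolding vdot_def smooth_field_def by (intro smooth_sum smooth_mult) auto

lemma smooth_field_vderiv: "smooth_field n V \<Longrightarrow> smooth_field n (vderiv V)"
  unfolding smooth_field_def vderiv_def by (auto intro: smooth_deriv)

lemma vdot_DERIV:
  assumes "smooth_field n V" "smooth_field n W"
  shows "((\<lambda>x. vdot n (V x) (W x)) has_real_derivative
    vdot n (vderiv V x) (W x) + vdot n (V x) (vderiv W x)) (at x)"
proof -
  have "((\<lambda>x. vdot n (V x) (W x)) has_real_derivative
      (\<Sum>i<n. V x i * vderiv W x i + vderiv V x i * W x i)) (at x)"
    unfolding vdot_def using assms
    by (intro DERIV_sum DERIV_mult') (auto simp: smooth_field_def vderiv_def intro!: smooth_DERIV)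
  then show ?thesis
    by (rule DERIV_cong) (simp add: vdot_def sum.distrib)
qed

text \<open>
  The one fact about the geometry that the estimates rest on is the product rule
  \<open>nabla_curv_vdot_DERIV\<close> below: the operator \<open>\<nabla>\<^sub>s\<close> differs from \<open>\<partial>\<^sub>s\<close> by a tangential vector, and
  this difference is invisible to inner products with the normal fields \<open>\<nabla>\<^sub>s\<^sup>i \<kappa>\<close>.
\<close>

context
  fixes n :: nat and \<gamma> :: "real \<Rightarrow> rvec"
  assumes immersion: "smooth_immersion n \<gamma>"
begin

lemma smooth_field_curve: "smooth_field n \<gamma>"
  using immersion by (simp add: smooth_immersion_def smooth_field_def)

lemma speed_pos: "0 < speed n \<gamma> x"
proof -
  obtain i where "i < n" "vderiv \<gamma> x i \<noteq> 0"
    using immersion unfolding smooth_immersion_def by blast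
  then have "0 < vdot n (vderiv \<gamma> x) (vderiv \<gamma> x)"
    unfolding vdot_def by (intro sum_pos2[of _ i]) (auto simp: zero_less_mult_iff linorder_neq_iff)
  then show ?thesis by (simp add: speed_def vnorm_eq)
qed

lemma smooth_speed: "smooth (speed n \<gamma>)"
proof -
  have "0 < vdot n (vderiv \<gamma> x) (vderiv \<gamma> x)" for x
    using speed_pos[of x] by (simp add: speed_def vnorm_eq)
  then show ?thesis
    unfolding speed_def[abs_def] vnorm_eq
    by (intro smooth_sqrt smooth_vdot smooth_field_vderiv smooth_field_curve)
qed

lemma smooth_field_ds_vec:
  assumes "smooth_field n V" shows "smooth_field n (ds_vec n \<gamma> V)"
  unfolding smooth_field_def
proof (intro allI impI)
  fix i assume "i < n"
  then have "smooth (\<lambda>x. vderiv V x i)"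
    using smooth_field_vderiv[OF assms] by (simp add: smooth_field_def)
  moreover have "speed n \<gamma> x \<noteq> 0" for x using speed_pos[of x] by simp
  ultimately show "smooth (\<lambda>x. ds_vec n \<gamma> V x i)"
    unfolding ds_vec_def using smooth_speed by (intro smooth_divide)
qed

lemma smooth_field_nabla_s:
  assumes "smooth_field n V" shows "smooth_field n (nabla_s n \<gamma> V)"
proof -
  note T = smooth_field_ds_vec[OF smooth_field_curve] and D = smooth_field_ds_vec[OF assms]
  show ?thesis
    unfolding smooth_field_def nabla_s_def
    using T D smooth_vdot[OF D T]
    by (auto simp: smooth_field_def intro!: smooth_diff smooth_mult)
qed

lemma smooth_field_nabla_curv: "smooth_field n (nabla_curv n \<gamma> i)"
  unfolding nabla_curv_def
  by (induction i)
    (simp_all add: curvature_def smooth_field_ds_vec smooth_field_nabla_s smooth_field_curve)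

lemma vdot_DERIV_ds_vec:
  assumes "smooth_field n V" "smooth_field n W"
  shows "((\<lambda>x. vdot n (V x) (W x)) has_real_derivative
    speed n \<gamma> x * (vdot n (ds_vec n \<gamma> V x) (W x) + vdot n (V x) (ds_vec n \<gamma> W x))) (at x)"
proof (rule DERIV_cong[OF vdot_DERIV[OF assms]])
  have "vderiv U x = (\<lambda>i. speed n \<gamma> x * ds_vec n \<gamma> U x i)" for U
    using speed_pos[of x] by (simp add: ds_vec_def)
  then show "vdot n (vderiv V x) (W x) + vdot n (V x) (vderiv W x)
      = speed n \<gamma> x * (vdot n (ds_vec n \<gamma> V x) (W x) + vdot n (V x) (ds_vec n \<gamma> W x))"
    by (simp add: vdot_def sum_distrib_left algebra_simps)
qed

lemma tangent_unit: "vdot n (ds_vec n \<gamma> \<gamma> x) (ds_vec n \<gamma> \<gamma> x) = 1"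
proof -
  have "vdot n (ds_vec n \<gamma> \<gamma> x) (ds_vec n \<gamma> \<gamma> x)
      = vdot n (vderiv \<gamma> x) (vderiv \<gamma> x) / (speed n \<gamma> x)\<^sup>2"
    by (simp add: vdot_def ds_vec_def sum_divide_distrib power2_eq_square)
  also have "\<dots> = 1"
    using speed_pos[of x] unfolding speed_def vnorm_power2[symmetric] by simp
  finally show ?thesis .
qed

lemma curvature_normal: "vdot n (curvature n \<gamma> x) (ds_vec n \<gamma> \<gamma> x) = 0"
proof -
  note T = smooth_field_ds_vec[OF smooth_field_curve]
  have "((\<lambda>x. 1) has_real_derivative
      speed n \<gamma> x * (2 * vdot n (curvature n \<gamma> x) (ds_vec n \<gamma> \<gamma> x))) (at x)"
    using vdot_DERIV_ds_vec[OF T T, of x]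
    by (simp add: tangent_unit curvature_def vdot_commute[of n "ds_vec n \<gamma> \<gamma> x"])
  then have "speed n \<gamma> x * (2 * vdot n (curvature n \<gamma> x) (ds_vec n \<gamma> \<gamma> x)) = 0"
    using DERIV_const DERIV_unique by blast
  then show ?thesis using speed_pos[of x] by simp
qed

lemma nabla_s_normal: "vdot n (nabla_s n \<gamma> V x) (ds_vec n \<gamma> \<gamma> x) = 0"
  unfolding nabla_s_def vdot_diff_scale tangent_unit by simp

lemma nabla_curv_normal: "vdot n (nabla_curv n \<gamma> i x) (ds_vec n \<gamma> \<gamma> x) = 0"
  unfolding nabla_curv_def
  by (cases i) (simp_all add: curvature_normal nabla_s_normal)

lemma nabla_curv_vdot_DERIV:
  "((\<lambda>x. vdot n (nabla_curv n \<gamma> i x) (nabla_curv n \<gamma> j x)) has_real_derivative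
    speed n \<gamma> x * (vdot n (nabla_curv n \<gamma> (Suc i) x) (nabla_curv n \<gamma> j x)
                  + vdot n (nabla_curv n \<gamma> i x) (nabla_curv n \<gamma> (Suc j) x))) (at x)"
proof -
  have *: "vdot n (nabla_curv n \<gamma> (Suc i) x) (nabla_curv n \<gamma> j x)
      = vdot n (ds_vec n \<gamma> (nabla_curv n \<gamma> i) x) (nabla_curv n \<gamma> j x)" for i j
    using nabla_curv_normal[of j x]
    by (simp add: nabla_curv_def nabla_s_def vdot_diff_scale vdot_commute[of n "ds_vec n \<gamma> \<gamma> x"])
  show ?thesis
    using vdot_DERIV_ds_vec[OF smooth_field_nabla_curv smooth_field_nabla_curv, of i j x]
    by (simp add: * vdot_commute[of n "nabla_curv n \<gamma> i x"])
qed

end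

section \<open>Integral inequalities for a cut-off sequence\<close>

text \<open>
  The estimates see the curve only through the inner products of the fields
  \<open>V i = \<nabla>\<^sub>s\<^sup>i \<kappa>\<close>, the speed \<open>w\<close> and the cut-off function. Since these inner products obey a
  product rule with respect to \<open>w\<^sup>-\<^sup>1 d/dx\<close>, integration by parts is available.
\<close>

locale cutoff_sequence =
  fixes n :: nat and w :: "real \<Rightarrow> real" and V :: "nat \<Rightarrow> real \<Rightarrow> rvec"
    and \<zeta> \<zeta>' :: "real \<Rightarrow> real" and \<Lambda> :: real
  assumes w_pos: "\<And>x. 0 < w x"
    and w_cont: "continuous_on UNIV w"
    and V_DERIV: "\<And>i j x. ((\<lambda>x. vdot n (V i x) (V j x)) has_real_derivative
           w x * (vdot n (V (Suc i) x) (V j x) + vdot n (V i x) (V (Suc j) x))) (at x)"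
    and \<zeta>_DERIV: "\<And>x. (\<zeta> has_real_derivative \<zeta>' x) (at x)"
    and \<zeta>'_cont: "continuous_on UNIV \<zeta>'"
    and \<zeta>'_bound: "\<And>x. \<bar>\<zeta>' x\<bar> \<le> \<Lambda> * w x"
    and \<zeta>_nonneg: "\<And>x. 0 \<le> \<zeta> x"
    and \<zeta>_support: "bounded {x. \<zeta> x \<noteq> 0}"
begin

definition pos_set :: "real set" where "pos_set = {x. 0 < \<zeta> x}"

text \<open>
  The weight \<open>\<zeta>\<^sup>i\<close> on the \<open>i\<close>-th derivative is dictated by scaling: \<open>\<zeta>\<close> behaves like a length
  because \<open>\<bar>\<partial>\<^sub>s \<zeta>\<bar> \<le> \<Lambda>\<close>, and each derivative costs one length. The integrals below extend over
  the positivity set of \<open>\<zeta>\<close> and not over the line, so that for \<open>i = 0\<close>, where the weight is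
  \<open>1\<close>, they are finite and give the energy of \<open>\<kappa>\<close> on \<open>[\<zeta> > 0]\<close>.
\<close>

definition weighted :: "nat \<Rightarrow> real \<Rightarrow> real" where
  "weighted i x = \<zeta> x ^ i * vnorm n (V i x)"

definition energy :: "nat \<Rightarrow> real" where
  "energy i = (LINT x:pos_set|lborel. (weighted i x)\<^sup>2 * w x)"

definition wnorm :: "nat \<Rightarrow> real" where
  "wnorm i = sqrt (energy i)"

lemma \<zeta>_cont: "continuous_on UNIV \<zeta>"
  by (rule DERIV_continuous_on[OF \<zeta>_DERIV])

lemma V_cont: "continuous_on UNIV (\<lambda>x. vdot n (V i x) (V j x))"
  by (rule DERIV_continuous_on[OF V_DERIV])

lemma weighted_cont: "continuous_on UNIV (weighted i)"
  unfolding weighted_def[abs_def] vnorm_eq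
  by (intro continuous_intros \<zeta>_cont V_cont)

lemma weighted_nonneg: "0 \<le> weighted i x"
  by (simp add: weighted_def \<zeta>_nonneg vnorm_nonneg)

lemma \<Lambda>_nonneg: "0 \<le> \<Lambda>"
  using \<zeta>'_bound[of 0] w_pos[of 0] by (smt (verit) mult_less_0_iff)

lemma \<zeta>_zero: "x \<notin> pos_set \<Longrightarrow> \<zeta> x = 0"
  using \<zeta>_nonneg[of x] by (simp add: pos_set_def)

text \<open>
  A zero of the nonnegative function \<open>\<zeta>\<close> is a minimum.
\<close>

lemma \<zeta>'_zero:
  assumes "x \<notin> pos_set" shows "\<zeta>' x = 0"
  by (rule DERIV_local_min[OF \<zeta>_DERIV zero_less_one])
    (simp add: \<zeta>_zero[OF assms] \<zeta>_nonneg)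

lemma pos_set_subset_interval: obtains R where "0 < R" "pos_set \<subseteq> {-R<..<R}"
proof -
  obtain r where r: "\<And>x. \<zeta> x \<noteq> 0 \<Longrightarrow> \<bar>x\<bar> \<le> r"
    using \<zeta>_support unfolding bounded_iff by auto
  show ?thesis
  proof (rule that[of "\<bar>r\<bar> + 1"])
    show "pos_set \<subseteq> {-(\<bar>r\<bar> + 1)<..<\<bar>r\<bar> + 1}"
    proof
      fix x assume "x \<in> pos_set"
      then have "\<bar>x\<bar> \<le> r" by (intro r) (simp add: pos_set_def)
      then show "x \<in> {-(\<bar>r\<bar> + 1)<..<\<bar>r\<bar> + 1}" by auto
    qed
  qed simp
qed

lemma pos_set_measurable: "pos_set \<in> sets lborel"
proof -
  have "open pos_set" unfolding pos_set_def by (intro open_Collect_less continuous_intros \<zeta>_cont)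
  then show ?thesis by simp
qed

lemma set_integrable_pos_set:
  fixes f :: "real \<Rightarrow> real"
  assumes "continuous_on UNIV f"
  shows "set_integrable lborel pos_set f"
proof -
  obtain R where R: "pos_set \<subseteq> {-R<..<R}" by (rule pos_set_subset_interval)
  have "set_integrable lborel {-R..R} f"
    unfolding set_integrable_def
    by (rule borel_integrable_compact) (auto intro: continuous_on_subset[OF assms])
  then show ?thesis
    by (rule set_integrable_subset) (use R pos_set_measurable in auto)
qed

lemma set_integral_S_nonneg:
  "(\<And>x. 0 \<le> f x) \<Longrightarrow> 0 \<le> (LINT x:pos_set|lborel. f x :: real)"
  unfolding set_lebesgue_integral_def by (rule integral_nonneg_AE) simp

lemma set_integral_S_mono:
  fixes f g :: "real \<Rightarrow> real"
  assumes "continuous_on UNIV f" "continuous_on UNIV g" "\<And>x. f x \<le> g x"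
  shows "(LINT x:pos_set|lborel. f x) \<le> (LINT x:pos_set|lborel. g x)"
  by (intro set_integral_mono set_integrable_pos_set assms)

text \<open>
  These are the two uses of the compact support: there are no boundary terms in an
  integration by parts, and a function is controlled by the integral of its derivative from
  a point outside of the support.
\<close>

lemma
  fixes F F' :: "real \<Rightarrow> real"
  assumes F: "\<And>x. (F has_real_derivative F' x) (at x)" and F': "continuous_on UNIV F'"
    and zero: "\<And>x. x \<notin> pos_set \<Longrightarrow> F x = 0" "\<And>x. x \<notin> pos_set \<Longrightarrow> F' x = 0"
  shows integral_derivative_eq_0: "(LINT x:pos_set|lborel. F' x) = 0"
    and abs_le_integral_abs_derivative: "\<bar>F x\<bar> \<le> (LINT x:pos_set|lborel. \<bar>F' x\<bar>)"
proof -
  obtain R where R: "0 < R" "pos_set \<subseteq> {-R<..<R}" by (rule pos_set_subset_interval)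
  have ends: "F (-R) = 0" "F R = 0" using R(2) by (auto intro!: zero)
  have FTC: "(LINT y:{-R..x}|lborel. F' y) = F x" if "-R \<le> x" for x
    using integral_FTC_Icc_real[of "-R" x F F'] that F F' ends
    by (simp add: set_lebesgue_integral_def mult.commute continuous_on_eq_continuous_at)
  have interval: "(LINT y:pos_set|lborel. g y) = (LINT y:{-R..R}|lborel. g y)"
    if "\<And>y. y \<notin> pos_set \<Longrightarrow> g y = 0" for g :: "real \<Rightarrow> real"
    unfolding set_lebesgue_integral_def
    using R(2) that by (intro Bochner_Integration.integral_cong) (auto simp: indicator_def)
  show "(LINT x:pos_set|lborel. F' x) = 0"
    using interval[OF zero(2)] FTC[of R] R(1) ends by simp
  have F'_abs: "set_integrable lborel pos_set (\<lambda>y. \<bar>F' y\<bar>)"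
    by (intro set_integrable_pos_set continuous_intros F')
  show "\<bar>F x\<bar> \<le> (LINT x:pos_set|lborel. \<bar>F' x\<bar>)"
  proof (cases "x \<in> pos_set")
    case True
    then have x: "-R \<le> x" "x \<le> R" using R(2) by auto
    have "\<bar>F x\<bar> = \<bar>LINT y:{-R..x}|lborel. F' y\<bar>" using FTC[OF x(1)] by simp
    also have "\<dots> \<le> (LINT y:{-R..x}|lborel. \<bar>F' y\<bar>)"
      unfolding set_lebesgue_integral_def
      by (rule order_trans[OF integral_abs_bound]) (simp add: abs_mult)
    also have "\<dots> \<le> (LINT y:pos_set|lborel. \<bar>F' y\<bar>)"
      unfolding set_lebesgue_integral_def
      using F'_abs zero(2)
      by (intro integral_mono') (auto simp: set_integrable_def indicator_def)
    finally show ?thesis .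
  next
    case False
    then show ?thesis using zero(1) by (simp add: set_integral_S_nonneg)
  qed
qed

text \<open>
  The quadratic polynomial \<open>t \<mapsto> \<integral> (t f + g)\<^sup>2 w\<close> is nonnegative, so its discriminant is not
  positive.
\<close>

lemma Cauchy_Schwarz_pos_set:
  assumes f: "continuous_on UNIV f" and g: "continuous_on UNIV g"
  shows "(LINT x:pos_set|lborel. f x * g x * w x)
    \<le> sqrt (LINT x:pos_set|lborel. (f x)\<^sup>2 * w x) * sqrt (LINT x:pos_set|lborel. (g x)\<^sup>2 * w x)"
proof -
  define p q r where pqr: "p = (LINT x:pos_set|lborel. (f x)\<^sup>2 * w x)"
    "q = (LINT x:pos_set|lborel. f x * g x * w x)" "r = (LINT x:pos_set|lborel. (g x)\<^sup>2 * w x)"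
  have nonneg: "0 \<le> p" "0 \<le> r"
    unfolding pqr by (intro set_integral_S_nonneg; simp add: less_imp_le w_pos)+
  have quad: "0 \<le> t\<^sup>2 * p + 2 * t * q + r" for t
  proof -
    have "0 \<le> (LINT x:pos_set|lborel. (t * f x + g x)\<^sup>2 * w x)"
      by (intro set_integral_S_nonneg) (simp add: less_imp_le w_pos)
    also have "\<dots> = (LINT x:pos_set|lborel.
        (t\<^sup>2 * ((f x)\<^sup>2 * w x) + 2 * t * (f x * g x * w x)) + (g x)\<^sup>2 * w x)"
      by (simp add: power2_sum algebra_simps power_mult_distrib)
    also have "\<dots> = t\<^sup>2 * p + 2 * t * q + r"
      unfolding pqr
      by (subst set_integral_add; (intro set_integrable_pos_set continuous_intros f g w_cont)?)+ simp
    finally show ?thesis .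
  qed
  have "q\<^sup>2 \<le> p * r"
  proof (cases "p = 0")
    case True
    have "q = 0"
    proof (rule ccontr)
      assume "q \<noteq> 0"
      then show False using quad[of "- (r + 1) / (2 * q)"] True by (simp add: field_simps)
    qed
    then show ?thesis using True by simp
  next
    case False
    then have "0 \<le> r - q\<^sup>2 / p"
      using quad[of "- q / p"] by (simp add: field_simps power2_eq_square)
    then show ?thesis using False nonneg by (simp add: field_simps)
  qed
  then have "q \<le> sqrt (p * r)" by (rule real_le_rsqrt)
  then show ?thesis unfolding pqr[symmetric] real_sqrt_mult .
qed

lemma wnorm_nonneg: "0 \<le> wnorm i"
  unfolding wnorm_def energy_def
  by (intro real_sqrt_ge_zero set_integral_S_nonneg) (simp add: less_imp_le w_pos)

lemma wnorm_power2: "(wnorm i)\<^sup>2 = energy i"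
  unfolding wnorm_def energy_def
  by (intro real_sqrt_pow2 set_integral_S_nonneg) (simp add: less_imp_le w_pos)

lemma integral_weighted_le: "(LINT x:pos_set|lborel. weighted i x * weighted j x * w x) \<le> wnorm i * wnorm j"
  unfolding wnorm_def energy_def by (rule Cauchy_Schwarz_pos_set[OF weighted_cont weighted_cont])

lemma abs_power_vdot_le: "\<bar>\<zeta> x ^ (i + j) * vdot n (V i x) (V j x)\<bar> \<le> weighted i x * weighted j x"
proof -
  have "\<bar>\<zeta> x ^ (i + j) * vdot n (V i x) (V j x)\<bar>
      \<le> \<zeta> x ^ (i + j) * (vnorm n (V i x) * vnorm n (V j x))"
    using \<zeta>_nonneg[of x] abs_vdot_le by (simp add: abs_mult mult_left_mono)
  then show ?thesis by (simp add: weighted_def power_add mult_ac)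
qed

lemma weighted_power2: "(weighted i x)\<^sup>2 = \<zeta> x ^ (2 * i) * vdot n (V i x) (V i x)"
  by (simp add: weighted_def power_mult_distrib vnorm_power2 power_even_eq)

text \<open>
  Integrating the derivative of \<open>\<zeta>\<^sup>2\<^sup>i\<^sup>+\<^sup>2 \<langle>V i, V (i + 1)\<rangle>\<close> gives zero. The three terms of this
  derivative are the square to be estimated, a product of the two neighbouring orders, and
  a term in which one factor \<open>\<zeta>\<close> has been differentiated; this last factor is bounded by \<open>\<Lambda>\<close>
  and leaves exactly the weights of the orders \<open>i\<close> and \<open>i + 1\<close>.
\<close>

lemma wnorm_interpolation:
  "(wnorm (Suc i))\<^sup>2 \<le> wnorm i * wnorm (Suc (Suc i)) + 2 * real (Suc i) * \<Lambda> * (wnorm i * wnorm (Suc i))"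
proof -
  define F where "F x = \<zeta> x ^ (2 * i + 2) * vdot n (V i x) (V (Suc i) x)" for x
  define F' where "F' x = \<zeta> x ^ (2 * i + 2) * (w x * (vdot n (V (Suc i) x) (V (Suc i) x)
        + vdot n (V i x) (V (Suc (Suc i)) x)))
      + real (2 * i + 2) * \<zeta> x ^ (2 * i + 1) * \<zeta>' x * vdot n (V i x) (V (Suc i) x)" for x
  have F: "(F has_real_derivative F' x) (at x)" for x
    unfolding F_def F'_def
    by (rule DERIV_cong[OF DERIV_mult'[OF DERIV_power[OF \<zeta>_DERIV] V_DERIV]]) simp
  have F'_cont: "continuous_on UNIV F'"
    unfolding F'_def by (intro continuous_intros w_cont \<zeta>_cont \<zeta>'_cont V_cont)
  have zero: "(LINT x:pos_set|lborel. F' x) = 0"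
    by (rule integral_derivative_eq_0[OF F F'_cont]) (simp_all add: F_def F'_def \<zeta>_zero)
  let ?G = "\<lambda>x. weighted i x * weighted (Suc (Suc i)) x * w x
      + 2 * real (Suc i) * \<Lambda> * (weighted i x * weighted (Suc i) x * w x)"
  have le: "(weighted (Suc i) x)\<^sup>2 * w x \<le> F' x + ?G x" for x
  proof -
    have 1: "- (\<zeta> x ^ (2 * i + 2) * vdot n (V i x) (V (Suc (Suc i)) x)) * w x
        \<le> weighted i x * weighted (Suc (Suc i)) x * w x"
      using abs_power_vdot_le[of x i "Suc (Suc i)"] w_pos[of x]
      by (intro mult_right_mono) (auto simp: mult_2)
    have 2: "- (\<zeta>' x * (\<zeta> x ^ (2 * i + 1) * vdot n (V i x) (V (Suc i) x)))
        \<le> (\<Lambda> * w x) * (weighted i x * weighted (Suc i) x)"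
    proof -
      have "- (\<zeta>' x * (\<zeta> x ^ (2 * i + 1) * vdot n (V i x) (V (Suc i) x)))
          \<le> \<bar>\<zeta>' x\<bar> * \<bar>\<zeta> x ^ (2 * i + 1) * vdot n (V i x) (V (Suc i) x)\<bar>"
        unfolding abs_mult[symmetric] by linarith
      also have "\<dots> \<le> (\<Lambda> * w x) * (weighted i x * weighted (Suc i) x)"
        using abs_power_vdot_le[of x i "Suc i"] \<zeta>'_bound[of x] weighted_nonneg
        by (intro mult_mono) (auto simp: mult_2)
      finally show ?thesis .
    qed
    have 3: "real (2 * i + 2) * - (\<zeta>' x * (\<zeta> x ^ (2 * i + 1) * vdot n (V i x) (V (Suc i) x)))
        \<le> real (2 * i + 2) * ((\<Lambda> * w x) * (weighted i x * weighted (Suc i) x))"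
      by (rule mult_left_mono[OF 2]) simp
    have 4: "(weighted (Suc i) x)\<^sup>2 * w x
        = \<zeta> x ^ (2 * i + 2) * vdot n (V (Suc i) x) (V (Suc i) x) * w x"
      by (simp add: weighted_power2)
    show ?thesis
      using 1 3 unfolding 4 F'_def by (simp add: algebra_simps)
  qed
  have "(wnorm (Suc i))\<^sup>2 \<le> (LINT x:pos_set|lborel. F' x + ?G x)"
    unfolding wnorm_power2 energy_def
    by (intro set_integral_S_mono le continuous_intros weighted_cont w_cont F'_cont)
  also have "\<dots> = (LINT x:pos_set|lborel. ?G x)"
    by (subst set_integral_add)
      (auto simp: zero intro!: set_integrable_pos_set continuous_intros weighted_cont w_cont F'_cont)
  also have "\<dots> = (LINT x:pos_set|lborel. weighted i x * weighted (Suc (Suc i)) x * w x)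
      + 2 * real (Suc i) * \<Lambda> * (LINT x:pos_set|lborel. weighted i x * weighted (Suc i) x * w x)"
    by (subst set_integral_add)
      (auto intro!: set_integrable_pos_set continuous_intros weighted_cont w_cont)
  also have "\<dots> \<le> wnorm i * wnorm (Suc (Suc i)) + 2 * real (Suc i) * \<Lambda> * (wnorm i * wnorm (Suc i))"
    using \<Lambda>_nonneg by (intro add_mono mult_left_mono integral_weighted_le) auto
  finally show ?thesis .
qed

text \<open>
  The function \<open>\<zeta>\<^sup>2\<^sup>i\<^sup>+\<^sup>1 \<bar>V i\<bar>\<^sup>2\<close> is bounded pointwise by the integral of the modulus of its
  derivative. The supremum norm thus carries half a power of \<open>\<zeta>\<close> more than the square
  integral does, in accordance with scaling.
\<close>

lemma weighted_sup_bound: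
  "\<zeta> x * (weighted i x)\<^sup>2 \<le> 2 * (wnorm i * wnorm (Suc i)) + real (2 * i + 1) * \<Lambda> * (wnorm i)\<^sup>2"
proof -
  define F where "F x = \<zeta> x ^ (2 * i + 1) * vdot n (V i x) (V i x)" for x
  define F' where "F' x = \<zeta> x ^ (2 * i + 1) * (w x * (vdot n (V (Suc i) x) (V i x)
        + vdot n (V i x) (V (Suc i) x)))
      + real (2 * i + 1) * \<zeta> x ^ (2 * i) * \<zeta>' x * vdot n (V i x) (V i x)" for x
  have F: "(F has_real_derivative F' x) (at x)" for x
    unfolding F_def F'_def
    by (rule DERIV_cong[OF DERIV_mult'[OF DERIV_power[OF \<zeta>_DERIV] V_DERIV]]) simp
  have F'_cont: "continuous_on UNIV F'"
    unfolding F'_def by (intro continuous_intros w_cont \<zeta>_cont \<zeta>'_cont V_cont)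
  let ?G = "\<lambda>x. 2 * (weighted i x * weighted (Suc i) x * w x)
      + real (2 * i + 1) * \<Lambda> * ((weighted i x)\<^sup>2 * w x)"
  have le: "\<bar>F' x\<bar> \<le> ?G x" for x
  proof -
    have 1: "\<bar>\<zeta> x ^ (2 * i + 1) * vdot n (V i x) (V (Suc i) x) * w x\<bar>
        \<le> weighted i x * weighted (Suc i) x * w x"
      unfolding abs_mult[of _ "w x"]
      using abs_power_vdot_le[of x i "Suc i"] w_pos[of x]
      by (intro mult_mono) (auto simp: mult_2 less_imp_le)
    have 2: "\<bar>\<zeta>' x * (weighted i x)\<^sup>2\<bar> \<le> (\<Lambda> * w x) * (weighted i x)\<^sup>2"
      using \<zeta>'_bound[of x] by (simp add: abs_mult mult_right_mono)
    have 3: "\<bar>real (2 * i + 1) * (\<zeta>' x * (weighted i x)\<^sup>2)\<bar>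
        \<le> real (2 * i + 1) * ((\<Lambda> * w x) * (weighted i x)\<^sup>2)"
      unfolding abs_mult[of "real (2 * i + 1)"] using 2 by (intro mult_mono) auto
    have "F' x = 2 * (\<zeta> x ^ (2 * i + 1) * vdot n (V i x) (V (Suc i) x) * w x)
        + real (2 * i + 1) * (\<zeta>' x * (weighted i x)\<^sup>2)"
      unfolding F'_def weighted_power2
      by (simp add: vdot_commute[of n "V (Suc i) x"] algebra_simps)
    then have "\<bar>F' x\<bar> \<le> 2 * \<bar>\<zeta> x ^ (2 * i + 1) * vdot n (V i x) (V (Suc i) x) * w x\<bar>
        + \<bar>real (2 * i + 1) * (\<zeta>' x * (weighted i x)\<^sup>2)\<bar>"
      by linarith
    also have "\<dots> \<le> ?G x" using 1 3 by (simp add: algebra_simps)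
    finally show ?thesis .
  qed
  have "\<zeta> x * (weighted i x)\<^sup>2 = \<bar>F x\<bar>"
    using \<zeta>_nonneg vdot_self_nonneg by (simp add: F_def weighted_power2 abs_mult)
  also have "\<dots> \<le> (LINT x:pos_set|lborel. \<bar>F' x\<bar>)"
    by (rule abs_le_integral_abs_derivative[OF F F'_cont]) (simp_all add: F_def F'_def \<zeta>_zero \<zeta>'_zero)
  also have "\<dots> \<le> (LINT x:pos_set|lborel. ?G x)"
    by (intro set_integral_S_mono le continuous_intros weighted_cont w_cont F'_cont)
  also have "\<dots> = 2 * (LINT x:pos_set|lborel. weighted i x * weighted (Suc i) x * w x)
      + real (2 * i + 1) * \<Lambda> * (LINT x:pos_set|lborel. (weighted i x)\<^sup>2 * w x)"
    by (subst set_integral_add)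
      (auto intro!: set_integrable_pos_set continuous_intros weighted_cont w_cont)
  also have "\<dots> \<le> 2 * (wnorm i * wnorm (Suc i)) + real (2 * i + 1) * \<Lambda> * (wnorm i)\<^sup>2"
    unfolding wnorm_power2 energy_def
    using \<Lambda>_nonneg by (intro add_mono mult_left_mono integral_weighted_le) auto
  finally show ?thesis .
qed

end

section \<open>Interpolation for log-convex sequences\<close>

text \<open>
  Convexity of \<open>i \<mapsto> ln (c i)\<close>, written with natural powers so that it remains meaningful when
  members of the sequence vanish. The induction on \<open>k\<close> first compares \<open>c k\<close> with \<open>c 0\<close> and
  \<open>c (k + 1)\<close>; the estimates for lower orders then follow by inserting this into the
  induction hypothesis.
\<close>

lemma log_convex_interpolation:
  fixes c :: "nat \<Rightarrow> real"
  assumes "\<And>i. 0 \<le> c i" and "\<And>i. i + 2 \<le> k \<Longrightarrow> (c (Suc i))\<^sup>2 \<le> c i * c (i + 2)" and "i \<le> k"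
  shows "c i ^ k \<le> c 0 ^ (k - i) * c k ^ i"
  using assms
proof (induction k arbitrary: i)
  case (Suc k)
  note c = \<open>\<And>i. 0 \<le> c i\<close>
  have IH: "c i ^ k \<le> c 0 ^ (k - i) * c k ^ i" if "i \<le> k" for i
    using Suc.prems(2) that by (intro Suc.IH c) auto
  have last: "c k ^ Suc k \<le> c 0 * c (Suc k) ^ k"
  proof (cases "k = 0 \<or> c k = 0")
    case True
    then show ?thesis using c by auto
  next
    case False
    then obtain m where k: "k = Suc m" by (auto simp: gr0_conv_Suc)
    have exponent: "m + Suc k = 2 * k" by (simp add: k)
    have "c k ^ m * c k ^ Suc k = ((c k)\<^sup>2) ^ k"
      by (simp only: power_add[symmetric] power_mult[symmetric] exponent)
    also have "\<dots> \<le> (c m * c (Suc k)) ^ k"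
      using Suc.prems(2)[of m] c by (intro power_mono) (auto simp: k)
    also have "\<dots> \<le> (c 0 * c k ^ m) * c (Suc k) ^ k"
      unfolding power_mult_distrib
      using IH[of m] c by (intro mult_right_mono) (auto simp: k)
    finally have "c k ^ m * c k ^ Suc k \<le> c k ^ m * (c 0 * c (Suc k) ^ k)"
      by (simp only: mult_ac)
    moreover have "0 < c k ^ m"
    proof -
      have "0 < c k" using False c[of k] by linarith
      then show ?thesis by simp
    qed
    ultimately show ?thesis by (rule mult_left_le_imp_le)
  qed
  show ?case
  proof (cases "i = Suc k \<or> k = 0")
    case True
    then show ?thesis using Suc.prems(3) c by (auto simp: le_Suc_eq)
  next
    case False
    then have i: "i \<le> k" "0 < k" using Suc.prems(3) by auto
    have "(c i ^ Suc k) ^ k = (c i ^ k) ^ Suc k"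
      by (simp only: power_mult[symmetric] mult.commute)
    also have "\<dots> \<le> (c 0 ^ (k - i) * c k ^ i) ^ Suc k"
      using IH[OF i(1)] c by (intro power_mono) auto
    also have "\<dots> = (c 0 ^ (k - i)) ^ Suc k * (c k ^ Suc k) ^ i"
      by (simp only: power_mult_distrib power_mult[symmetric] mult.commute)
    also have "\<dots> \<le> (c 0 ^ (k - i)) ^ Suc k * (c 0 * c (Suc k) ^ k) ^ i"
      using last c by (intro mult_left_mono power_mono) auto
    also have "\<dots> = (c 0 ^ (Suc k - i) * c (Suc k) ^ i) ^ k"
    proof -
      obtain d where d: "k = i + d" using i(1) le_Suc_ex by blast
      have "(c 0 ^ (k - i)) ^ Suc k * c 0 ^ i = (c 0 ^ (Suc k - i)) ^ k"
        unfolding power_mult[symmetric] power_add[symmetric] by (simp add: d algebra_simps)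
      moreover have "(c (Suc k) ^ k) ^ i = (c (Suc k) ^ i) ^ k"
        by (simp only: power_mult[symmetric] mult.commute)
      ultimately show ?thesis
        by (simp only: power_mult_distrib mult.assoc[symmetric])
    qed
    finally show ?thesis
      using power_mono_iff[of "c i ^ Suc k" "c 0 ^ (Suc k - i) * c (Suc k) ^ i" k] i(2) c by simp
  qed
qed simp

text \<open>
  The sequence \<open>E\<^bsup>j * j\<^esup> b j\<close> is log-convex: the second difference of \<open>j * j\<close> is \<open>2\<close>, which
  compensates a factor \<open>E\<^sup>2 \<ge> E\<close>.
\<close>

lemma almost_log_convex_interpolation:
  fixes b :: "nat \<Rightarrow> real"
  assumes b: "\<And>i. 0 \<le> b i" and E: "1 \<le> E"
    and step: "\<And>i. i + 2 \<le> k \<Longrightarrow> (b (Suc i))\<^sup>2 \<le> E * (b i * b (i + 2))" and i: "i \<le> k"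
  shows "b i ^ k \<le> (E ^ (k * k)) ^ k * (b 0 ^ (k - i) * b k ^ i)"
proof -
  define c where "c j = E ^ (j * j) * b j" for j
  have c_nonneg: "0 \<le> c j" for j using b E by (simp add: c_def)
  have c_step: "(c (Suc j))\<^sup>2 \<le> c j * c (j + 2)" if "j + 2 \<le> k" for j
  proof -
    have "(c (Suc j))\<^sup>2 = E ^ (2 * (Suc j * Suc j)) * (b (Suc j))\<^sup>2"
      by (simp only: c_def power_mult_distrib power_even_eq)
    also have "\<dots> \<le> E ^ (2 * (Suc j * Suc j)) * (E\<^sup>2 * (b j * b (j + 2)))"
    proof -
      have "(b (Suc j))\<^sup>2 \<le> E\<^sup>2 * (b j * b (j + 2))"
        using step[OF that] E b self_le_power[of E 2]
        by (meson mult_nonneg_nonneg mult_right_mono order_trans zero_less_numeral)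
      then show ?thesis using E by (intro mult_left_mono) auto
    qed
    also have "\<dots> = c j * c (j + 2)"
    proof -
      have "2 * (Suc j * Suc j) + 2 = j * j + (j + 2) * (j + 2)"
        by (simp add: algebra_simps)
      then have "E ^ (2 * (Suc j * Suc j)) * E\<^sup>2 = E ^ (j * j) * E ^ ((j + 2) * (j + 2))"
        by (metis power_add)
      then have "E ^ (2 * (Suc j * Suc j)) * (E\<^sup>2 * (b j * b (j + 2)))
          = E ^ (j * j) * E ^ ((j + 2) * (j + 2)) * (b j * b (j + 2))"
        by (simp only: mult.assoc[symmetric])
      then show ?thesis by (simp only: c_def mult_ac)
    qed
    finally show ?thesis .
  qed
  have main: "c i ^ k \<le> c 0 ^ (k - i) * c k ^ i"
    by (rule log_convex_interpolation[OF c_nonneg c_step i])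
  have "b i ^ k \<le> c i ^ k"
    unfolding c_def using mult_right_mono[of 1 "E ^ (i * i)" "b i"] E b[of i]
    by (intro power_mono) auto
  also have "\<dots> \<le> (E ^ (k * k)) ^ i * (b 0 ^ (k - i) * b k ^ i)"
    using main by (simp add: c_def power_mult_distrib mult_ac)
  also have "\<dots> \<le> (E ^ (k * k)) ^ k * (b 0 ^ (k - i) * b k ^ i)"
    using E b i by (intro mult_right_mono power_increasing) auto
  finally show ?thesis .
qed

text \<open>
  The second factor comes from the interpolation between orders \<open>0\<close> and \<open>k\<close>, where \<open>1 + 2 k \<Lambda>\<close>
  is the constant in the almost log-convexity. The first factor accounts for the passage to
  supremum norms.
\<close>

definition interpolation_const :: "real \<Rightarrow> nat \<Rightarrow> real" where
  "interpolation_const \<Lambda> k = (2 + (2 * real k + 1) * \<Lambda>) * (1 + 2 * real k * \<Lambda>) ^ (k * k)"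

lemma interpolation_const_ge_1:
  assumes "0 \<le> \<Lambda>" shows "1 \<le> interpolation_const \<Lambda> k"
proof -
  have "1 * 1 \<le> interpolation_const \<Lambda> k"
    unfolding interpolation_const_def using assms by (intro mult_mono one_le_power) auto
  then show ?thesis by simp
qed

context cutoff_sequence
begin

lemma wnorm_eq_0: "wnorm 0 = 0 \<Longrightarrow> wnorm i = 0"
proof (induction i)
  case (Suc i)
  then show ?case using wnorm_interpolation[of i] by simp
qed

text \<open>
  The running maximum \<open>b i\<close> of the norms up to order \<open>i\<close> is almost log-convex: where the
  maximum is attained at a positive order, integration by parts applies, and \<open>b\<close> is monotone
  at the other places. With \<open>\<rho>\<^sup>k = b k / b 0\<close>, interpolation says that order \<open>i\<close> costs
  a factor \<open>\<rho>\<^sup>i\<close>, and half an order more in the supremum norm. If the maximum \<open>b k\<close> is not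
  the norm of order \<open>k\<close> itself, it is attained at a lower order and interpolation bounds \<open>\<rho>\<close>
  by a constant; hence the alternative in the last conclusion. If the norm of
  order \<open>0\<close> is zero, then all of them are, and \<open>\<rho> = 1\<close> satisfies everything.
\<close>

lemma scaled_bounds:
  assumes k: "1 \<le> k"
  defines "L \<equiv> interpolation_const \<Lambda> k"
  obtains \<rho> where "1 \<le> \<rho>"
    and "\<And>i. i \<le> k \<Longrightarrow> wnorm i \<le> L * wnorm 0 * \<rho> powr i"
    and "\<And>i x. i < k \<Longrightarrow> sqrt (\<zeta> x) * weighted i x \<le> L * wnorm 0 * \<rho> powr (i + 1/2)"
    and "\<rho> \<le> L \<or> wnorm 0 * \<rho> ^ k \<le> wnorm k"
proof (cases "wnorm 0 = 0")
  case True
  have "sqrt (\<zeta> x) * weighted i x \<le> 0" for i x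
  proof -
    have "\<zeta> x * (weighted i x)\<^sup>2 \<le> 0"
      using weighted_sup_bound[of x i] by (simp add: wnorm_eq_0[OF True])
    then have "(sqrt (\<zeta> x) * weighted i x)\<^sup>2 \<le> 0"
      by (simp add: power_mult_distrib \<zeta>_nonneg)
    then show ?thesis by auto
  qed
  then show thesis
    using True wnorm_eq_0[OF True] interpolation_const_ge_1[OF \<Lambda>_nonneg, of k]
    by (intro that[of 1]) (auto simp: L_def)
next
  case False
  define E where "E = 1 + 2 * real k * \<Lambda>"
  define H where "H = 2 + (2 * real k + 1) * \<Lambda>"
  define M where "M = E ^ (k * k)"
  have E: "1 \<le> E" and H: "1 \<le> H" and M: "1 \<le> M"
    using \<Lambda>_nonneg by (simp_all add: E_def H_def M_def)
  have L: "L = H * M" by (simp add: L_def interpolation_const_def E_def H_def M_def)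
  have M_le_L: "M \<le> L" using H M by (simp add: L)
  define b where "b i = Max (wnorm ` {..i})" for i
  have wnorm_le_b: "wnorm j \<le> b i" if "j \<le> i" for i j
    unfolding b_def using that by (intro Max_ge) auto
  have b_attained: "\<exists>j\<le>i. b i = wnorm j" for i
  proof -
    have "b i \<in> wnorm ` {..i}" unfolding b_def by (rule Max_in) auto
    then show ?thesis by auto
  qed
  have b_nonneg: "0 \<le> b i" for i using wnorm_le_b[of i i] wnorm_nonneg[of i] by linarith
  have b0: "b 0 = wnorm 0" by (simp add: b_def)
  have A0: "0 < wnorm 0" using False wnorm_nonneg[of 0] by simp
  have step: "(b (Suc i))\<^sup>2 \<le> E * (b i * b (i + 2))" if i: "i + 2 \<le> k" for i
  proof -
    obtain j where j: "j \<le> Suc i" "b (Suc i) = wnorm j" using b_attained by blast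
    show ?thesis
    proof (cases j)
      case 0
      then have "b (Suc i) \<le> b i" "b (Suc i) \<le> b (i + 2)"
        using j(2) wnorm_le_b by auto
      then have "(b (Suc i))\<^sup>2 \<le> 1 * (b i * b (i + 2))"
        unfolding power2_eq_square using b_nonneg by (auto intro: mult_mono)
      also have "\<dots> \<le> E * (b i * b (i + 2))"
        using E b_nonneg by (intro mult_right_mono) auto
      finally show ?thesis .
    next
      case (Suc m)
      then have m: "m \<le> i" using j(1) by simp
      have 1: "wnorm m * wnorm (Suc (Suc m)) \<le> b i * b (i + 2)" "wnorm m * wnorm (Suc m) \<le> b i * b (i + 2)"
        using m wnorm_nonneg b_nonneg wnorm_le_b by (intro mult_mono; simp)+
      have 2: "2 * real (Suc m) * \<Lambda> * (wnorm m * wnorm (Suc m)) \<le> 2 * real k * \<Lambda> * (b i * b (i + 2))"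
      proof (rule mult_mono[OF _ 1(2)])
        show "2 * real (Suc m) * \<Lambda> \<le> 2 * real k * \<Lambda>"
          using m i \<Lambda>_nonneg by (intro mult_right_mono) auto
      qed (simp_all add: \<Lambda>_nonneg wnorm_nonneg)
      show ?thesis
        using wnorm_interpolation[of m] 1(1) 2 unfolding j(2) Suc E_def
        by (simp add: algebra_simps)
    qed
  qed
  \<comment> \<open>the factor gained per order of differentiation\<close>
  define \<rho> where "\<rho> = root k (b k / wnorm 0)"
  have \<rho>k: "\<rho> ^ k = b k / wnorm 0"
    unfolding \<rho>_def using k A0 b_nonneg by (intro real_root_pow_pos2) auto
  have \<rho>: "1 \<le> \<rho>"
    unfolding \<rho>_def using k A0 wnorm_le_b[of 0 k] by simp
  have b_le: "b i \<le> M * wnorm 0 * \<rho> ^ i" if i: "i \<le> k" for i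
  proof -
    have "b i ^ k \<le> M ^ k * (wnorm 0 ^ (k - i) * (wnorm 0 * \<rho> ^ k) ^ i)"
      using almost_log_convex_interpolation[of b E k i, OF b_nonneg E step i] A0
      by (simp add: M_def b0 \<rho>k)
    also have "wnorm 0 ^ (k - i) * (wnorm 0 * \<rho> ^ k) ^ i = (wnorm 0 * \<rho> ^ i) ^ k"
    proof -
      have "wnorm 0 ^ (k - i) * wnorm 0 ^ i = wnorm 0 ^ k" using i by (simp add: power_add[symmetric])
      then show ?thesis
        by (simp add: power_mult_distrib power_mult[symmetric] mult.commute mult.left_commute)
    qed
    finally have "b i ^ k \<le> (M * wnorm 0 * \<rho> ^ i) ^ k"
      by (simp add: power_mult_distrib mult.assoc)
    then show ?thesis
      using k M A0 \<rho> by (subst (asm) power_mono_iff) (auto simp: b_nonneg)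
  qed
  show thesis
  proof (rule that[OF \<rho>])
    fix i assume "i \<le> k"
    have "wnorm i \<le> M * wnorm 0 * \<rho> ^ i" using b_le[OF \<open>i \<le> k\<close>] wnorm_le_b[of i i] by simp
    also have "\<dots> \<le> L * wnorm 0 * \<rho> ^ i" using M_le_L A0 \<rho> by (intro mult_right_mono) auto
    finally show "wnorm i \<le> L * wnorm 0 * \<rho> powr i" using \<rho> by (simp add: powr_realpow)
  next
    fix i x assume i: "i < k"
    have "(sqrt (\<zeta> x) * weighted i x)\<^sup>2 = \<zeta> x * (weighted i x)\<^sup>2"
      by (simp add: power_mult_distrib \<zeta>_nonneg)
    also have "\<dots> \<le> 2 * (wnorm i * wnorm (Suc i)) + real (2 * i + 1) * \<Lambda> * (wnorm i)\<^sup>2"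
      by (rule weighted_sup_bound)
    also have "\<dots> \<le> H * (b i * b (Suc i))"
    proof -
      have 1: "wnorm i * wnorm (Suc i) \<le> b i * b (Suc i)" "(wnorm i)\<^sup>2 \<le> b i * b (Suc i)"
        unfolding power2_eq_square
        using wnorm_nonneg b_nonneg wnorm_le_b by (intro mult_mono; simp)+
      have "real (2 * i + 1) * \<Lambda> * (wnorm i)\<^sup>2 \<le> (2 * real k + 1) * \<Lambda> * (b i * b (Suc i))"
        using 1(2) i \<Lambda>_nonneg by (intro mult_mono) auto
      then show ?thesis using 1(1) by (simp add: H_def algebra_simps)
    qed
    also have "\<dots> \<le> H * ((M * wnorm 0 * \<rho> ^ i) * (M * wnorm 0 * \<rho> ^ Suc i))"
      using b_le[of i] b_le[of "Suc i"] i b_nonneg H M A0 \<rho>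
      by (intro mult_left_mono mult_mono) auto
    also have "\<dots> = H * (M * wnorm 0)\<^sup>2 * (\<rho> powr (i + 1/2))\<^sup>2"
    proof -
      have "(\<rho> powr (i + 1/2))\<^sup>2 = \<rho> ^ i * \<rho> ^ Suc i"
      proof -
        have "(\<rho> powr (i + 1/2))\<^sup>2 = \<rho> powr real (i + Suc i)"
          using \<rho> by (simp add: power2_eq_square powr_add[symmetric] algebra_simps)
        also have "\<dots> = \<rho> ^ (i + Suc i)" using \<rho> by (subst powr_realpow) auto
        finally show ?thesis by (simp only: power_add)
      qed
      then show ?thesis by (simp add: power2_eq_square mult_ac)
    qed
    also have "\<dots> \<le> H\<^sup>2 * (M * wnorm 0)\<^sup>2 * (\<rho> powr (i + 1/2))\<^sup>2"
      using H by (intro mult_right_mono self_le_power) auto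
    also have "\<dots> = (L * wnorm 0 * \<rho> powr (i + 1/2))\<^sup>2"
      by (simp add: L power_mult_distrib)
    finally show "sqrt (\<zeta> x) * weighted i x \<le> L * wnorm 0 * \<rho> powr (i + 1/2)"
      using H M A0 by (intro power2_le_imp_le[of "sqrt (\<zeta> x) * weighted i x"]) (auto simp: L)
  next
    obtain j where j: "j \<le> k" "b k = wnorm j" using b_attained by blast
    show "\<rho> \<le> L \<or> wnorm 0 * \<rho> ^ k \<le> wnorm k"
    proof (cases "j = k")
      case True
      then show ?thesis using j A0 by (simp add: \<rho>k)
    next
      case False
      then obtain d where d: "k = j + Suc d"
        using j(1) by (metis le_neq_implies_less less_iff_Suc_add add_Suc_right)
      have "wnorm 0 * \<rho> ^ k \<le> M * wnorm 0 * \<rho> ^ j"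
        using b_le[OF j(1)] wnorm_le_b[of j j] j(2) A0 by (simp add: \<rho>k)
      then have "(wnorm 0 * \<rho> ^ j) * \<rho> ^ Suc d \<le> (wnorm 0 * \<rho> ^ j) * M"
        by (simp only: d power_add mult_ac)
      moreover have "0 < wnorm 0 * \<rho> ^ j" using A0 \<rho> by simp
      ultimately have "\<rho> ^ Suc d \<le> M" by (rule mult_left_le_imp_le)
      moreover have "\<rho> \<le> \<rho> ^ Suc d" using \<rho> by (intro self_le_power) auto
      ultimately show ?thesis using M_le_L by linarith
    qed
  qed
qed

end

section \<open>Integrals of products of derivatives\<close>

context cutoff_sequence
begin

text \<open>
  The exponent of \<open>\<zeta>\<close> is the sum of the exponents \<open>l + 1/2\<close> that belong to the supremum norms.
\<close>

lemma prod_norm_powr_le: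
  assumes "0 < \<zeta> x" and "\<And>l. l \<in> set js \<Longrightarrow> sqrt (\<zeta> x) * weighted l x \<le> N l"
  shows "prod_list (map (\<lambda>j. vnorm n (V j x)) js) * \<zeta> x powr (real (sum_list js) + length js / 2)
    \<le> prod_list (map N js)"
  using assms(2)
proof (induction js)
  case Nil
  then show ?case using assms(1) by simp
next
  case (Cons l js)
  let ?Q = "prod_list (map (\<lambda>j. vnorm n (V j x)) js)"
  have IH: "?Q * \<zeta> x powr (real (sum_list js) + length js / 2) \<le> prod_list (map N js)"
    using Cons by auto
  have Q: "0 \<le> ?Q" by (rule prod_list_nonneg) (auto simp: vnorm_nonneg)
  have "prod_list (map (\<lambda>j. vnorm n (V j x)) (l # js))
        * \<zeta> x powr (real (sum_list (l # js)) + length (l # js) / 2)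
      = (sqrt (\<zeta> x) * weighted l x) * (?Q * \<zeta> x powr (real (sum_list js) + length js / 2))"
  proof -
    have "\<zeta> x powr (real (sum_list (l # js)) + length (l # js) / 2)
        = \<zeta> x powr (1/2) * \<zeta> x powr l * \<zeta> x powr (real (sum_list js) + length js / 2)"
      unfolding powr_add[symmetric] by (simp add: add_divide_distrib algebra_simps)
    then show ?thesis
      using assms(1) by (simp add: powr_half_sqrt powr_realpow weighted_def mult_ac)
  qed
  also have "\<dots> \<le> N l * prod_list (map N js)"
    using Cons.prems[of l] IH Q weighted_nonneg[of l x] \<zeta>_nonneg[of x]
    by (intro mult_mono) (auto intro: order_trans[rotated])
  finally show ?case by simp
qed

text \<open>
  Two of the factors are put into square integrals and all others into supremum norms. The
  weights add up: \<open>\<zeta>\<^sup>i\<close> and \<open>\<zeta>\<^sup>j\<close> for the first two, \<open>\<zeta>\<^bsup>l + 1/2\<^esup>\<close> for each of the others,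
  which for \<open>b\<close> factors of total order \<open>a\<close> is \<open>\<zeta>\<close> to the power \<open>a + (b - 2) / 2\<close>. An
  integrable majorant is stated instead of a bound for the integral, because majorants of
  several terms can be added without measurability of the left-hand sides.
\<close>

lemma prod_le_integrable:
  assumes js: "mset js = mset (i # j # rest)"
    and N: "\<And>l x. l \<in> set rest \<Longrightarrow> sqrt (\<zeta> x) * weighted l x \<le> N l"
  obtains g where "integrable lborel g" and "\<And>x. 0 \<le> g x"
    and "\<And>x. prod_list (map (\<lambda>j. vnorm n (V j x)) js)
              * \<zeta> x powr (real (sum_list js) + length js / 2 - 1) * w x \<le> g x"
    and "(LINT x|lborel. g x) \<le> prod_list (map N rest) * (wnorm i * wnorm j)"
proof (rule that)
  let ?h = "\<lambda>x. indicator pos_set x *\<^sub>R (weighted i x * weighted j x * w x)"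
  let ?g = "\<lambda>x. prod_list (map N rest) * ?h x"
  have N_nonneg: "0 \<le> N l" if "l \<in> set rest" for l
    using N[OF that, of 0] weighted_nonneg[of l 0] \<zeta>_nonneg[of 0]
    by (meson mult_nonneg_nonneg order_trans real_sqrt_ge_zero)
  then have prod_nonneg: "0 \<le> prod_list (map N rest)"
    by (intro prod_list_nonneg) auto
  have "set_integrable lborel pos_set (\<lambda>x. weighted i x * weighted j x * w x)"
    by (intro set_integrable_pos_set continuous_intros weighted_cont w_cont)
  then show "integrable lborel ?g"
    unfolding set_integrable_def by (rule integrable_mult_right)
  show "0 \<le> ?g x" for x
    using prod_nonneg weighted_nonneg w_pos[of x] by (simp add: less_imp_le)
  show "(LINT x|lborel. ?g x) \<le> prod_list (map N rest) * (wnorm i * wnorm j)"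
    using integral_weighted_le[of i j] prod_nonneg
    by (simp add: set_lebesgue_integral_def mult_left_mono)
  show "prod_list (map (\<lambda>j. vnorm n (V j x)) js)
      * \<zeta> x powr (real (sum_list js) + length js / 2 - 1) * w x \<le> ?g x" for x
  proof (cases "x \<in> pos_set")
    case False
    then show ?thesis by (simp add: \<zeta>_zero)
  next
    case True
    then have pos: "0 < \<zeta> x" by (simp add: pos_set_def)
    have sums: "sum_list js = i + j + sum_list rest" "length js = 2 + length rest"
      using js sum_mset_sum_list[of js] sum_mset_sum_list[of "i # j # rest"] mset_eq_length[OF js]
      by simp_all
    have "prod_list (map (\<lambda>j. vnorm n (V j x)) js)
        = prod_mset (image_mset (\<lambda>j. vnorm n (V j x)) (mset js))"
      by (simp only: mset_map[symmetric] prod_mset_prod_list)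
    also have "\<dots> = vnorm n (V i x) * (vnorm n (V j x)
        * prod_list (map (\<lambda>j. vnorm n (V j x)) rest))"
      unfolding js by (simp add: prod_mset_prod_list flip: mset_map)
    finally have prods: "prod_list (map (\<lambda>j. vnorm n (V j x)) js)
        = vnorm n (V i x) * (vnorm n (V j x) * prod_list (map (\<lambda>j. vnorm n (V j x)) rest))" .
    have powers: "\<zeta> x powr (real (sum_list js) + length js / 2 - 1)
        = \<zeta> x ^ i * \<zeta> x ^ j * \<zeta> x powr (real (sum_list rest) + length rest / 2)"
    proof -
      have "real (sum_list js) + length js / 2 - 1
          = real i + real j + (real (sum_list rest) + length rest / 2)"
        unfolding sums by (simp add: add_divide_distrib)
      then show ?thesis using pos by (simp only: powr_add powr_realpow)
    qed
    have "prod_list (map (\<lambda>j. vnorm n (V j x)) js)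
        * \<zeta> x powr (real (sum_list js) + length js / 2 - 1) * w x
      = (prod_list (map (\<lambda>j. vnorm n (V j x)) rest)
          * \<zeta> x powr (real (sum_list rest) + length rest / 2))
        * (weighted i x * weighted j x * w x)"
      unfolding prods powers by (simp add: weighted_def mult_ac)
    also have "\<dots> \<le> prod_list (map N rest) * (weighted i x * weighted j x * w x)"
      using weighted_nonneg w_pos[of x] N
      by (intro mult_right_mono prod_norm_powr_le pos) (auto simp: less_imp_le)
    finally show ?thesis using True by simp
  qed
qed

lemma prod_list_scaled:
  assumes "1 \<le> \<rho>"
  shows "prod_list (map (\<lambda>l. B * \<rho> powr (real l + 1/2)) js)
    = B ^ length js * \<rho> powr (real (sum_list js) + length js / 2)"
proof (induction js)
  case (Cons l js)
  have "\<rho> powr (real (sum_list (l # js)) + length (l # js) / 2)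
      = \<rho> powr (real l + 1/2) * \<rho> powr (real (sum_list js) + length js / 2)"
    unfolding powr_add[symmetric] by (simp add: add_divide_distrib algebra_simps)
  then show ?case using Cons by simp
qed (use assms in simp)

end

text \<open>
  Supremum norms are under control for orders below \<open>k\<close> only. A factor of order \<open>k\<close> must
  therefore be one of the two square-integrated ones, which is possible because the total
  order below \<open>2 k\<close> allows at most one such factor.
\<close>

lemma split_two_factors:
  fixes js :: "nat list"
  assumes "2 \<le> length js" "\<forall>j\<in>set js. j \<le> k" "sum_list js < 2 * k"
  obtains i j rest where "mset js = mset (i # j # rest)" "i \<le> k" "j \<le> k" "\<forall>l\<in>set rest. l < k"
proof (cases "k \<in> set js")
  case True
  obtain j rest where r: "remove1 k js = j # rest"
    using assms(1) length_remove1[of k js] True by (cases "remove1 k js") auto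
  have js: "mset js = mset (k # j # rest)"
    using True r by (metis mset.simps(2) mset_remove1 insert_DiffM set_mset_mset)
  then have "sum_list js = k + (j + sum_list rest)"
    using sum_mset_sum_list[of js] sum_mset_sum_list[of "k # j # rest"] by simp
  then have s: "j + sum_list rest < k" using assms(3) by simp
  then have "\<forall>l\<in>set rest. l < k" using member_le_sum_list by fastforce
  then show thesis using js s by (intro that) auto
next
  case False
  obtain i j rest where js: "js = i # j # rest"
    using assms(1) by (cases js rule: list.exhaust[case_product list.exhaust])
      (metis One_nat_def Suc_1 Suc_le_length_iff)+
  show thesis using False assms(2) js by (intro that[of i j rest]) (auto simp: le_less)
qed

context cutoff_sequence
begin

text \<open>
  Every factor contributes one \<open>B\<close>, and the exponents \<open>i\<close>, \<open>j\<close>, \<open>l + 1/2\<close> of \<open>\<rho>\<close> add up to the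
  same \<open>p\<close> as those of \<open>\<zeta>\<close>: this is the scaling invariance of the estimates.
\<close>

lemma term_bound:
  assumes "1 \<le> \<rho>"
    and L2: "\<And>i. i \<le> k \<Longrightarrow> wnorm i \<le> B * \<rho> powr i"
    and sup: "\<And>i x. i < k \<Longrightarrow> sqrt (\<zeta> x) * weighted i x \<le> B * \<rho> powr (i + 1/2)"
    and js: "2 \<le> length js" "\<forall>j\<in>set js. j \<le> k" "sum_list js < 2 * k"
  defines "p \<equiv> real (sum_list js) + length js / 2 - 1"
  shows "\<exists>g. integrable lborel g \<and> (\<forall>x. 0 \<le> g x) \<and>
    (\<forall>x. prod_list (map (\<lambda>j. vnorm n (V j x)) js) * \<zeta> x powr p * w x \<le> g x) \<and>
    (LINT x|lborel. g x) \<le> B ^ length js * \<rho> powr p"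
proof -
  obtain i j rest where ms: "mset js = mset (i # j # rest)" and ij: "i \<le> k" "j \<le> k"
    and rest: "\<forall>l\<in>set rest. l < k"
    using split_two_factors[OF js] by metis
  let ?N = "\<lambda>l. B * \<rho> powr (real l + 1/2)"
  obtain g where g: "integrable lborel g" "\<And>x. 0 \<le> g x"
    "\<And>x. prod_list (map (\<lambda>j. vnorm n (V j x)) js) * \<zeta> x powr p * w x \<le> g x"
    "(LINT x|lborel. g x) \<le> prod_list (map ?N rest) * (wnorm i * wnorm j)"
    using prod_le_integrable[OF ms, of ?N] rest sup unfolding p_def by metis
  have B: "0 \<le> B"
    using L2[OF ij(1)] wnorm_nonneg[of i] assms(1)
    by (smt (verit) powr_gt_zero mult_neg_pos)
  have sums: "sum_list js = i + j + sum_list rest" "length js = 2 + length rest"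
    using ms sum_mset_sum_list[of js] sum_mset_sum_list[of "i # j # rest"] mset_eq_length[OF ms]
    by simp_all
  have "prod_list (map ?N rest) * (wnorm i * wnorm j)
      \<le> prod_list (map ?N rest) * ((B * \<rho> powr i) * (B * \<rho> powr j))"
    using L2[OF ij(1)] L2[OF ij(2)] wnorm_nonneg B
    by (intro mult_left_mono mult_mono prod_list_nonneg) auto
  also have "\<dots> = B ^ length js * \<rho> powr p"
    unfolding prod_list_scaled[OF assms(1)] p_def sums
    by (simp add: power_add power2_eq_square powr_add powr_diff mult_ac add_divide_distrib)
  finally show ?thesis using g by (meson order_trans)
qed

lemma combination_bound:
  assumes "\<forall>(r, js)\<in>set P. \<exists>g. integrable lborel g \<and> (\<forall>x. 0 \<le> g x) \<and>
      (\<forall>x. F js x \<le> g x) \<and> (LINT x|lborel. g x) \<le> (B :: real)"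
  shows "\<exists>g. integrable lborel g \<and> (\<forall>x. 0 \<le> g x) \<and>
      (\<forall>x. (\<Sum>(r, js)\<leftarrow>P. \<bar>r\<bar> * F js x) \<le> g x) \<and>
      (LINT x|lborel. g x) \<le> (\<Sum>(r, js)\<leftarrow>P. \<bar>r\<bar>) * B"
  using assms
proof (induction P)
  case Nil
  show ?case by (intro exI[of _ "\<lambda>x. 0"]) simp
next
  case (Cons q P)
  obtain r js where q: "q = (r, js)" by (cases q)
  obtain g where g: "integrable lborel g" "\<And>x. 0 \<le> g x"
    "\<And>x. F js x \<le> g x" "(LINT x|lborel. g x) \<le> B"
    using Cons.prems unfolding q by auto
  obtain h where h: "integrable lborel h" "\<And>x. 0 \<le> h x"
    "\<And>x. (\<Sum>(r, js)\<leftarrow>P. \<bar>r\<bar> * F js x) \<le> h x"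
    "(LINT x|lborel. h x) \<le> (\<Sum>(r, js)\<leftarrow>P. \<bar>r\<bar>) * B"
    using Cons.IH Cons.prems by auto
  have "(LINT x|lborel. \<bar>r\<bar> * g x + h x) \<le> (\<Sum>(r, js)\<leftarrow>q # P. \<bar>r\<bar>) * B"
    using g(1,4) h(1,4) by (simp add: q distrib_right mult_left_mono add_mono)
  then show ?case
    using g(1-3) h(1-3)
    by (intro exI[of _ "\<lambda>x. \<bar>r\<bar> * g x + h x"]) (auto simp: q intro!: add_mono mult_left_mono)
qed

end

lemma vnorm_add: "vnorm n (\<lambda>i. u i + v i) \<le> vnorm n u + vnorm n v"
  unfolding vnorm_def by (rule L2_set_triangle_ineq)

lemma vnorm_scale: "vnorm n (\<lambda>i. c * v i) = \<bar>c\<bar> * vnorm n v"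
proof -
  have "vdot n (\<lambda>i. c * v i) (\<lambda>i. c * v i) = c\<^sup>2 * vdot n v v"
    by (simp add: vdot_def sum_distrib_left power2_eq_square mult_ac)
  then show ?thesis by (simp add: vnorm_eq real_sqrt_mult)
qed

lemma star_scalar_le: "\<bar>star_scalar n vs\<bar> \<le> prod_list (map (vnorm n) vs)"
  by (induction n vs rule: star_scalar.induct)
    (auto simp: vnorm_nonneg abs_mult mult.assoc[symmetric]
      intro!: mult_mono abs_vdot_le mult_nonneg_nonneg)

lemma star_vec_le: "vnorm n (star_vec n vs) \<le> prod_list (map (vnorm n) vs)"
proof (induction n vs rule: star_vec.induct)
  case (1 n u v vs)
  then show ?case
    by (auto simp: vnorm_nonneg vnorm_scale mult.assoc[symmetric]
      intro!: mult_mono abs_vdot_le mult_nonneg_nonneg)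
next
  case (3 n)
  have "vnorm n (\<lambda>i. 0) = 0" by (simp add: vnorm_eq vdot_def)
  then show ?case by simp
qed simp

lemma P_norm_le:
  "P_norm n \<gamma> b P x
    \<le> (\<Sum>(r, js)\<leftarrow>P. \<bar>r\<bar> * prod_list (map (\<lambda>j. vnorm n (nabla_curv n \<gamma> j x)) js))"
proof -
  define W where "W js = map (\<lambda>j. nabla_curv n \<gamma> j x) js" for js
  have W: "prod_list (map (\<lambda>j. vnorm n (nabla_curv n \<gamma> j x)) js) = prod_list (map (vnorm n) (W js))"
    for js by (simp add: W_def comp_def)
  have even_case: "\<bar>\<Sum>(r, js)\<leftarrow>P. r * star_scalar n (W js)\<bar>
      \<le> (\<Sum>(r, js)\<leftarrow>P. \<bar>r\<bar> * prod_list (map (vnorm n) (W js)))"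
  proof (induction P)
    case (Cons q P)
    obtain r js where q: "q = (r, js)" by (cases q)
    have "\<bar>r * star_scalar n (W js)\<bar> \<le> \<bar>r\<bar> * prod_list (map (vnorm n) (W js))"
      by (simp add: abs_mult mult_left_mono star_scalar_le)
    then show ?case using Cons by (simp add: q)
  qed simp
  have odd_case: "vnorm n (\<lambda>i. \<Sum>(r, js)\<leftarrow>P. r * star_vec n (W js) i)
      \<le> (\<Sum>(r, js)\<leftarrow>P. \<bar>r\<bar> * prod_list (map (vnorm n) (W js)))"
  proof (induction P)
    case Nil
    show ?case by (simp add: vnorm_eq vdot_def)
  next
    case (Cons q P)
    obtain r js where q: "q = (r, js)" by (cases q)
    have "vnorm n (\<lambda>i. r * star_vec n (W js) i) \<le> \<bar>r\<bar> * prod_list (map (vnorm n) (W js))"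
      by (simp add: vnorm_scale mult_left_mono star_vec_le)
    then show ?case
      using Cons vnorm_add[of n "\<lambda>i. r * star_vec n (W js) i"
          "\<lambda>i. \<Sum>(r, js)\<leftarrow>P. r * star_vec n (W js) i"]
      by (simp add: q)
  qed
  show ?thesis
    using even_case odd_case unfolding P_norm_def W W_def[symmetric] by simp
qed

section \<open>Absorbing the top-order term\<close>

text \<open>
  This is Young's inequality with the exponents \<open>2 / \<delta>\<close> and \<open>2 / (2 - \<delta>)\<close>. Distinguishing which
  of the two terms on the right dominates also covers \<open>\<delta> = 0\<close>.
\<close>

lemma absorb_power:
  fixes \<epsilon> D X y \<delta> :: real
  assumes "0 < \<epsilon>" "0 < D" "0 < X" "0 < y" "0 \<le> \<delta>" "\<delta> < 2"
  shows "D * X * y powr \<delta>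
    \<le> \<epsilon> * y\<^sup>2 + D * (D / \<epsilon>) powr (\<delta> / (2 - \<delta>)) * X powr (2 / (2 - \<delta>))"
proof (cases "D * X \<le> \<epsilon> * y powr (2 - \<delta>)")
  case True
  have "D * X * y powr \<delta> \<le> \<epsilon> * y powr (2 - \<delta>) * y powr \<delta>"
    using True by (rule mult_right_mono) simp
  also have "\<dots> = \<epsilon> * y\<^sup>2"
    using assms(4) by (simp add: mult.assoc powr_add[symmetric])
  finally show ?thesis using assms(2) by (simp add: add_increasing2)
next
  case False
  define t where "t = \<delta> / (2 - \<delta>)"
  have t: "0 \<le> t" "(2 - \<delta>) * t = \<delta>" "1 + t = 2 / (2 - \<delta>)"
    using assms(5,6) by (simp_all add: t_def field_simps)
  have "y powr (2 - \<delta>) \<le> D / \<epsilon> * X"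
    using False assms(1) by (simp add: field_simps)
  then have "(y powr (2 - \<delta>)) powr t \<le> (D / \<epsilon> * X) powr t"
    using t(1) by (intro powr_mono2) auto
  moreover have "(D / \<epsilon> * X) powr t = (D / \<epsilon>) powr t * X powr t"
    by (subst powr_mult) (use assms(1-3) in auto)
  ultimately have "y powr \<delta> \<le> (D / \<epsilon>) powr t * X powr t"
    using t(2) by (simp add: powr_powr)
  then have "D * X * y powr \<delta> \<le> D * X * ((D / \<epsilon>) powr t * X powr t)"
    using assms(2,3) by (intro mult_left_mono) auto
  also have "\<dots> = D * (D / \<epsilon>) powr t * X powr (1 + t)"
    using assms(3) by (simp add: powr_add)
  finally show ?thesis
    using assms(1) unfolding t_def[symmetric] t(3) by (simp add: add_increasing)
qed

text \<open>
  If \<open>\<rho>\<close> is bounded, the product is a multiple of \<open>x\<^sup>b\<close>. Otherwise \<open>\<rho>\<^sup>k \<le> y / x\<close>, the product is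
  at most \<open>x\<^bsup>b - \<delta>\<^esup> y\<^sup>\<delta>\<close>, and the power of \<open>y\<close> is absorbed because \<open>\<delta> < 2\<close>. The two cases are
  the origin of the two lower-order terms of the theorem.
\<close>

lemma scaled_product_le:
  fixes x y \<rho> \<epsilon> D L \<delta> :: real
  assumes pos: "0 < \<epsilon>" "0 < D" "1 \<le> \<rho>" and xy: "0 \<le> x" "0 \<le> y"
    and k: "1 \<le> k" and b: "2 \<le> b" and \<delta>: "0 \<le> \<delta>" "\<delta> < 2"
    and alt: "\<rho> \<le> L \<or> x * \<rho> ^ k \<le> y"
  shows "D * (x ^ b * \<rho> powr (real k * \<delta>))
    \<le> \<epsilon> * y\<^sup>2 + D * (D / \<epsilon>) powr (\<delta> / (2 - \<delta>)) * (x\<^sup>2) powr ((real b - \<delta>) / (2 - \<delta>))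
      + D * L powr (real k * \<delta>) * (x\<^sup>2) powr (real b / 2)"
proof (cases "x = 0")
  case True
  then show ?thesis using pos b by (simp add: power_0_left)
next
  case False
  then have x: "0 < x" using xy by simp
  have x2: "(x\<^sup>2) powr t = x powr (2 * t)" for t
    using x by (simp add: powr_powr flip: powr_numeral)
  have xb: "x ^ b = x powr b" using x by (simp add: powr_realpow)
  show ?thesis
    using alt
  proof
    assume "\<rho> \<le> L"
    then have "D * (x ^ b * \<rho> powr (real k * \<delta>)) \<le> D * (x ^ b * L powr (real k * \<delta>))"
      using pos x \<delta> by (intro mult_left_mono powr_mono2) auto
    also have "\<dots> = D * L powr (real k * \<delta>) * (x\<^sup>2) powr (real b / 2)"
      by (simp add: x2 xb)
    finally show ?thesis using pos by (simp add: add_increasing)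
  next
    assume le: "x * \<rho> ^ k \<le> y"
    moreover have "0 < x * \<rho> ^ k" using x pos by simp
    ultimately have y: "0 < y" by linarith
    have "x ^ b * \<rho> powr (real k * \<delta>) = x powr (real b - \<delta>) * (x * \<rho> ^ k) powr \<delta>"
      using x pos
      by (simp add: xb powr_mult powr_powr mult.assoc[symmetric] powr_add[symmetric]
          flip: powr_realpow)
    also have "\<dots> \<le> x powr (real b - \<delta>) * y powr \<delta>"
      using le \<delta> \<open>0 < x * \<rho> ^ k\<close> by (intro mult_left_mono powr_mono2) auto
    finally have "D * (x ^ b * \<rho> powr (real k * \<delta>)) \<le> D * x powr (real b - \<delta>) * y powr \<delta>"
      using pos by (simp add: mult_left_mono mult.assoc)
    also have "\<dots> \<le> \<epsilon> * y\<^sup>2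
        + D * (D / \<epsilon>) powr (\<delta> / (2 - \<delta>)) * (x powr (real b - \<delta>)) powr (2 / (2 - \<delta>))"
      using pos x y \<delta> by (intro absorb_power) auto
    also have "(x powr (real b - \<delta>)) powr (2 / (2 - \<delta>)) = (x\<^sup>2) powr ((real b - \<delta>) / (2 - \<delta>))"
      by (simp add: x2 powr_powr mult.commute)
    finally show ?thesis using pos by (simp add: add_increasing2)
  qed
qed

section \<open>The interpolation inequality for products of curvature derivatives\<close>

theorem proposition5p7:
  fixes k a b :: nat and \<epsilon> \<Lambda> \<delta> :: real and P :: lincomb
  assumes "\<epsilon> > 0" and "\<Lambda> > 0" and "k \<ge> 1" and "b \<ge> 2"
    and "real a + real b / 2 - 1 < 2 * real k"
    and "\<delta> = 1 / real k * (real a + real b / 2 - 1)"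
  shows "\<delta> < 2 \<and>
    (\<exists>C::real. \<forall>(c::nat) (n::nat) (\<gamma> :: real \<Rightarrow> rvec) (\<zeta> :: real \<Rightarrow> real).
       c \<le> k \<longrightarrow> P \<in> P_class a b c \<longrightarrow>
       n \<ge> 2 \<longrightarrow> smooth_immersion n \<gamma> \<longrightarrow>
       smooth \<zeta> \<longrightarrow> compact (closure {x. \<zeta> x \<noteq> 0}) \<longrightarrow>
       (\<forall>x. \<zeta> x \<ge> 0) \<longrightarrow> (\<forall>x. \<bar>ds_scalar n \<gamma> \<zeta> x\<bar> \<le> \<Lambda>) \<longrightarrow>
       integral_ds n \<gamma> UNIV (\<lambda>x. P_norm n \<gamma> b P x * \<zeta> x powr (real a + real b / 2 - 1))
       \<le> \<epsilon> * integral_ds n \<gamma> UNIV (\<lambda>x. (vnorm n (nabla_curv n \<gamma> k x))\<^sup>2 * \<zeta> x ^ (2 * k))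
         + C * integral_ds n \<gamma> {x. \<zeta> x > 0} (\<lambda>x. (vnorm n (curvature n \<gamma> x))\<^sup>2)
               powr ((real b - \<delta>) / (2 - \<delta>))
         + C * integral_ds n \<gamma> {x. \<zeta> x > 0} (\<lambda>x. (vnorm n (curvature n \<gamma> x))\<^sup>2)
               powr (real b / 2))"
proof -
  define p where "p = real a + real b / 2 - 1"
  have k: "0 < real k" using assms(3) by simp
  have p: "0 \<le> p" "p < 2 * real k" "p = real k * \<delta>"
    using assms(3-6) by (simp_all add: p_def)
  have \<delta>: "0 \<le> \<delta>" "\<delta> < 2"
    using p(1,2) k unfolding \<open>\<delta> = 1 / real k * _\<close> p_def[symmetric] by (simp_all add: field_simps)
  define L where "L = interpolation_const \<Lambda> k"
  have L: "1 \<le> L" unfolding L_def using assms(2) by (intro interpolation_const_ge_1) simp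
  define R where "R = (\<Sum>(r, js)\<leftarrow>P. \<bar>r\<bar>)"
  have R: "0 \<le> R" unfolding R_def by (intro sum_list_nonneg) auto
  define D where "D = (1 + R) * L ^ b"
  have D: "0 < D" unfolding D_def using R L by simp
  \<comment> \<open>The two constants of the absorption step; \<open>P\<close> enters through its coefficient sum \<open>R\<close> only.\<close>
  define C1 where "C1 = D * (D / \<epsilon>) powr (\<delta> / (2 - \<delta>))"
  define C2 where "C2 = D * L powr p"
  have C_nonneg: "0 \<le> C1" "0 \<le> C2" using D by (simp_all add: C1_def C2_def)
  show ?thesis
  proof (intro conjI exI[of _ "C1 + C2"] allI impI, fact \<delta>(2))
    fix c n :: nat and \<gamma> :: "real \<Rightarrow> rvec" and \<zeta> :: "real \<Rightarrow> real"
    assume c: "c \<le> k" and P: "P \<in> P_class a b c" and \<gamma>: "smooth_immersion n \<gamma>"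
      and \<zeta>: "smooth \<zeta>" "compact (closure {x. \<zeta> x \<noteq> 0})" "\<forall>x. 0 \<le> \<zeta> x"
      and \<Lambda>: "\<forall>x. \<bar>ds_scalar n \<gamma> \<zeta> x\<bar> \<le> \<Lambda>"
    interpret cutoff_sequence n "speed n \<gamma>" "nabla_curv n \<gamma>" \<zeta> "deriv \<zeta>" \<Lambda>
    proof
      show "\<bar>deriv \<zeta> x\<bar> \<le> \<Lambda> * speed n \<gamma> x" for x
      proof -
        have "\<bar>deriv \<zeta> x\<bar> = \<bar>ds_scalar n \<gamma> \<zeta> x\<bar> * speed n \<gamma> x"
          using speed_pos[OF \<gamma>, of x] by (simp add: ds_scalar_def)
        also have "\<dots> \<le> \<Lambda> * speed n \<gamma> x"
          using \<Lambda> speed_pos[OF \<gamma>, of x] by (intro mult_right_mono) auto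
        finally show ?thesis .
      qed
      show "bounded {x. \<zeta> x \<noteq> 0}"
        by (rule bounded_subset[OF compact_imp_bounded[OF \<zeta>(2)] closure_subset])
      show "0 < speed n \<gamma> x" for x by (rule speed_pos[OF \<gamma>])
      show "continuous_on UNIV (speed n \<gamma>)" by (rule smooth_continuous[OF smooth_speed[OF \<gamma>]])
      show "(\<zeta> has_real_derivative deriv \<zeta> x) (at x)" for x by (rule smooth_DERIV[OF \<zeta>(1)])
      show "continuous_on UNIV (deriv \<zeta>)" by (rule smooth_continuous[OF smooth_deriv[OF \<zeta>(1)]])
      show "0 \<le> \<zeta> x" for x using \<zeta>(3) by simp
    qed (rule nabla_curv_vdot_DERIV[OF \<gamma>])
    have energy_0: "integral_ds n \<gamma> {x. \<zeta> x > 0} (\<lambda>x. (vnorm n (curvature n \<gamma> x))\<^sup>2) = (wnorm 0)\<^sup>2"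
      unfolding wnorm_power2 energy_def integral_ds_def weighted_def pos_set_def nabla_curv_def by simp
    have energy_k: "integral_ds n \<gamma> UNIV
        (\<lambda>x. (vnorm n (nabla_curv n \<gamma> k x))\<^sup>2 * \<zeta> x ^ (2 * k)) = (wnorm k)\<^sup>2"
      unfolding wnorm_power2 energy_def integral_ds_def set_lebesgue_integral_def
      using assms(3) \<zeta>_zero
      by (intro Bochner_Integration.integral_cong)
        (auto simp: weighted_def power_mult_distrib power_even_eq indicator_def)
    obtain \<rho> where \<rho>: "1 \<le> \<rho>"
      and L2: "\<And>i. i \<le> k \<Longrightarrow> wnorm i \<le> L * wnorm 0 * \<rho> powr i"
      and sup: "\<And>i x. i < k \<Longrightarrow> sqrt (\<zeta> x) * weighted i x \<le> L * wnorm 0 * \<rho> powr (i + 1/2)"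
      and alt: "\<rho> \<le> L \<or> wnorm 0 * \<rho> ^ k \<le> wnorm k"
      using scaled_bounds[OF assms(3)] unfolding L_def by blast
    let ?B = "(L * wnorm 0) ^ b * \<rho> powr p"
    define F where "F js x = prod_list (map (\<lambda>j. vnorm n (nabla_curv n \<gamma> j x)) js)
        * \<zeta> x powr p * speed n \<gamma> x" for js x
    have "\<exists>g. integrable lborel g \<and> (\<forall>x. 0 \<le> g x) \<and> (\<forall>x. F js x \<le> g x)
        \<and> (LINT x|lborel. g x) \<le> ?B" if "(r, js) \<in> set P" for r js
    proof -
      have js: "length js = b" "sum_list js = a" "\<forall>j\<in>set js. j \<le> k"
        using P c that unfolding P_class_def by fastforce+
      have "real a < 2 * real k" using assms(4) p(2) by (simp add: p_def)
      then show ?thesis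
        using term_bound[OF \<rho> L2 sup, where js = js] js assms(4) unfolding F_def p_def by simp
    qed
    then obtain g where g: "integrable lborel g" "\<And>x. 0 \<le> g x"
      "\<And>x. (\<Sum>(r, js)\<leftarrow>P. \<bar>r\<bar> * F js x) \<le> g x" "(LINT x|lborel. g x) \<le> R * ?B"
      using combination_bound[of P F ?B] unfolding R_def by blast
    have le: "P_norm n \<gamma> b P x * \<zeta> x powr p * speed n \<gamma> x \<le> g x" for x
    proof -
      have "P_norm n \<gamma> b P x * (\<zeta> x powr p * speed n \<gamma> x)
          \<le> (\<Sum>(r, js)\<leftarrow>P. \<bar>r\<bar> * prod_list (map (\<lambda>j. vnorm n (nabla_curv n \<gamma> j x)) js))
            * (\<zeta> x powr p * speed n \<gamma> x)"
        using w_pos[of x] by (intro mult_right_mono P_norm_le) auto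
      also have "\<dots> = (\<Sum>(r, js)\<leftarrow>P. \<bar>r\<bar> * F js x)"
        by (induction P) (simp_all add: F_def case_prod_unfold algebra_simps)
      finally show ?thesis using g(3)[of x] by (simp add: mult.assoc)
    qed
    have "integral_ds n \<gamma> UNIV (\<lambda>x. P_norm n \<gamma> b P x * \<zeta> x powr p) \<le> (LINT x|lborel. g x)"
      unfolding integral_ds_def set_lebesgue_integral_def
      using g(1,2) le by (intro integral_mono') auto
    also have "\<dots> \<le> D * (wnorm 0 ^ b * \<rho> powr (real k * \<delta>))"
    proof -
      have "R * ?B \<le> (1 + R) * ?B"
        using L wnorm_nonneg by (intro mult_right_mono) auto
      then show ?thesis
        using g(4) by (simp add: D_def p(3) power_mult_distrib mult_ac)
    qed
    also have "\<dots> \<le> \<epsilon> * (wnorm k)\<^sup>2 + C1 * ((wnorm 0)\<^sup>2) powr ((real b - \<delta>) / (2 - \<delta>))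
        + C2 * ((wnorm 0)\<^sup>2) powr (real b / 2)"
      unfolding C1_def C2_def p(3)
      by (rule scaled_product_le[OF assms(1) D \<rho> wnorm_nonneg wnorm_nonneg assms(3,4) \<delta> alt])
    also have "\<dots> \<le> \<epsilon> * (wnorm k)\<^sup>2 + (C1 + C2) * ((wnorm 0)\<^sup>2) powr ((real b - \<delta>) / (2 - \<delta>))
        + (C1 + C2) * ((wnorm 0)\<^sup>2) powr (real b / 2)"
      using C_nonneg by (intro add_mono mult_right_mono) auto
    finally show "integral_ds n \<gamma> UNIV
        (\<lambda>x. P_norm n \<gamma> b P x * \<zeta> x powr (real a + real b / 2 - 1))
      \<le> \<epsilon> * integral_ds n \<gamma> UNIV (\<lambda>x. (vnorm n (nabla_curv n \<gamma> k x))\<^sup>2 * \<zeta> x ^ (2 * k))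
        + (C1 + C2) * integral_ds n \<gamma> {x. \<zeta> x > 0} (\<lambda>x. (vnorm n (curvature n \<gamma> x))\<^sup>2)
            powr ((real b - \<delta>) / (2 - \<delta>))
        + (C1 + C2) * integral_ds n \<gamma> {x. \<zeta> x > 0} (\<lambda>x. (vnorm n (curvature n \<gamma> x))\<^sup>2)
            powr (real b / 2)"
      unfolding energy_0 energy_k p_def .
  qed
qed

end
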